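(* Two homogeneous ultra-metric spaces $X,Y$ are coarsely equivalent if and only if $\mathrm{Ent}^\sharp(X)=\mathrm{Ent}^\sharp(Y)$.
   Context: A metric space $(X,d)$ is homogeneous if for any $x,y\in X$ there is an isometric bijection $f:X\to X$ with $f(x)=y$; it is an ultra-metric space if $d(x,y)\le\max\{d(x,z),d(z,y)\}$ for all $x,y,z\in X$. $B_\delta(x)=\{y\in X: d(x,y)\le\delta\}$. For a subset $B$ of a metric space and real $\varepsilon>0$, $\mathrm{Ent}_\varepsilon(B)$ is the smallest cardinality $|N|$ of an $\varepsilon$-net $N\subset B$, i.e. a subset such that for each $x\in B$ there is $y\in N$ with $\mathrm{dist}(x,y)<\varepsilon$. For $\varepsilon>0$, $\delta\ge0$ put $\mathrm{Ent}_\varepsilon^\delta(X)=\sup_{x\in X}\mathrm{Ent}_\varepsilon(B_\delta(x))$ (supremum of cardinals). Let $\kappa^+$ be the successor cardinal of a cardinal $\kappa$ (so $n^+=n+1$ for finite $n$). The (large) sharp entropy of $X$ is the cardinal $$\mathrm{Ent}^\sharp(X)=\min_{\varepsilon<\infty}\mathrm{Ent}^\sharp_\varepsilon(X),\qquad \mathrm{Ent}^\sharp_\varepsilon(X)=\sup_{\delta<\infty}\big(\mathrm{Ent}_\varepsilon^\delta(X)\big)^+ .$$ A map $f:X\to Y$ between metric spaces is bornologous if for every real $\varepsilon$ there is a real $\delta$ such that $\mathrm{dist}(x,x')\le\varepsilon$ implies $\mathrm{dist}(f(x),f(x'))\le\delta$. Metric spaces $X,Y$ are coarsely equivalent if there are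 bornologous maps $f:X\to Y$, $g:Y\to X$ with $\sup_{x\in X}\mathrm{dist}(g(f(x)),x)<\infty$ and $\sup_{y\in Y}\mathrm{dist}(f(g(y)),y)<\infty$. *)

theory Defs
  imports "HOL-Analysis.Analysis"
begin

unbundle cardinal_syntax

section \<open>Suprema and minima of sets of cardinals\<close>

text \<open>
  Cardinals are represented, as in the library, by relations \<open>r\<close> with \<open>Card_order r\<close>, taken up to
  \<open>=o\<close>; the operators below choose representatives. The least upper bound is formed among the
  cardinals that live on the type \<open>'a\<close>. Such bounds always exist, and by \<open>card_Sup_least\<close> the
  result is below every upper bound living on any type, so nothing depends on \<open>'a\<close>.
\<close>

definition card_Sup :: "'a rel set \<Rightarrow> 'a rel" where
  "card_Sup R = (SOME s. Card_order s \<and> (\<forall>r\<in>R. r \<le>o s) \<and>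
     (\<forall>s'::'a rel. Card_order s' \<and> (\<forall>r\<in>R. r \<le>o s') \<longrightarrow> s \<le>o s'))"

definition card_Min :: "'a rel set \<Rightarrow> 'a rel" where
  "card_Min R = (SOME r. r \<in> R \<and> (\<forall>r'\<in>R. r \<le>o r'))"

lemma card_Sup_aux:
  fixes R :: "'a rel set"
  assumes "\<And>r. r \<in> R \<Longrightarrow> Card_order r"
  shows "Card_order (card_Sup R) \<and> (\<forall>r\<in>R. r \<le>o card_Sup R) \<and>
     (\<forall>s'::'a rel. Card_order s' \<and> (\<forall>r\<in>R. r \<le>o s') \<longrightarrow> card_Sup R \<le>o s')"
proof -
  let ?U = "{s::'a rel. Card_order s \<and> (\<forall>r\<in>R. r \<le>o s)}"
  have "r \<le>o |UNIV::'a set|" if "r \<in> R" for r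
  proof -
    have "|Field r| =o r" using assms[OF that] by (rule card_of_Field_ordIso)
    moreover have "|Field r| \<le>o |UNIV::'a set|" by (rule card_of_mono1) simp
    ultimately show ?thesis using ordIso_symmetric ordIso_ordLeq_trans by blast
  qed
  then have "|UNIV::'a set| \<in> ?U" by (simp add: card_of_Card_order)
  then have "\<exists>s\<in>?U. \<forall>s'\<in>?U. s \<le>o s'" by (intro exists_minim_Card_order) auto
  then have "\<exists>s::'a rel. Card_order s \<and> (\<forall>r\<in>R. r \<le>o s) \<and>
     (\<forall>s'::'a rel. Card_order s' \<and> (\<forall>r\<in>R. r \<le>o s') \<longrightarrow> s \<le>o s')" by blast
  then show ?thesis unfolding card_Sup_def by (rule someI_ex)
qed

lemma card_Sup_Card_order:
  "(\<And>r. r \<in> R \<Longrightarrow> Card_order r) \<Longrightarrow> Card_order (card_Sup R)"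
  using card_Sup_aux[of R] by blast

lemma card_Sup_upper:
  "(\<And>r. r \<in> R \<Longrightarrow> Card_order r) \<Longrightarrow> r \<in> R \<Longrightarrow> r \<le>o card_Sup R"
  using card_Sup_aux[of R] by blast

lemma card_Sup_least:
  fixes R :: "'a rel set" and t :: "'b rel"
  assumes R: "\<And>r. r \<in> R \<Longrightarrow> Card_order r"
    and t: "Card_order t" "\<And>r. r \<in> R \<Longrightarrow> r \<le>o t"
  shows "card_Sup R \<le>o t"
proof (rule ccontr)
  assume neg: "\<not> card_Sup R \<le>o t"
  have "Well_order (card_Sup R)" "Well_order t"
    using card_Sup_Card_order[OF R] t(1) by (auto simp: card_order_on_well_order_on)
  then have "t <o card_Sup R"
    using neg by (simp add: not_ordLeq_iff_ordLess)
  then obtain p :: "'a rel" where p: "t =o p" "p <o card_Sup R"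
    using internalize_ordLess[of t "card_Sup R"] by blast
  have "Card_order p" using t(1) p(1) Card_order_ordIso2 by blast
  moreover have "\<forall>r\<in>R. r \<le>o p" using t(2) p(1) ordLeq_ordIso_trans by blast
  ultimately have "card_Sup R \<le>o p" using card_Sup_aux[OF R] by blast
  then show False using p(2) not_ordLess_ordLeq by blast
qed

lemma card_Min_in_least:
  assumes "R \<noteq> {}" "\<And>r. r \<in> R \<Longrightarrow> Card_order r"
  shows "card_Min R \<in> R" "r \<in> R \<Longrightarrow> card_Min R \<le>o r"
proof -
  have "\<exists>r. r \<in> R \<and> (\<forall>r'\<in>R. r \<le>o r')"
    using exists_minim_Card_order[of R] assms by blast
  then have "card_Min R \<in> R \<and> (\<forall>r'\<in>R. card_Min R \<le>o r')"
    unfolding card_Min_def by (rule someI_ex)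
  then show "card_Min R \<in> R" "r \<in> R \<Longrightarrow> card_Min R \<le>o r" by auto
qed


section \<open>Metric notions\<close>

text \<open>Metric spaces are elements of the type \<open>'a metric\<close>; the empty space is included.\<close>

definition homogeneous_metric :: "'a metric \<Rightarrow> bool" where
  "homogeneous_metric X \<longleftrightarrow> (\<forall>x\<in>mspace X. \<forall>y\<in>mspace X.
     \<exists>f. bij_betw f (mspace X) (mspace X) \<and>
         (\<forall>u\<in>mspace X. \<forall>v\<in>mspace X. mdist X (f u) (f v) = mdist X u v) \<and> f x = y)"

definition ultrametric :: "'a metric \<Rightarrow> bool" where
  "ultrametric X \<longleftrightarrow> (\<forall>x\<in>mspace X. \<forall>y\<in>mspace X. \<forall>z\<in>mspace X.
     mdist X x y \<le> max (mdist X x z) (mdist X z y))"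

definition bornologous_map :: "'a metric \<Rightarrow> 'b metric \<Rightarrow> ('a \<Rightarrow> 'b) \<Rightarrow> bool" where
  "bornologous_map X Y f \<longleftrightarrow> f \<in> mspace X \<rightarrow> mspace Y \<and>
     (\<forall>\<epsilon>::real. \<exists>\<delta>::real. \<forall>x\<in>mspace X. \<forall>x'\<in>mspace X.
        mdist X x x' \<le> \<epsilon> \<longrightarrow> mdist Y (f x) (f x') \<le> \<delta>)"

definition coarsely_equivalent :: "'a metric \<Rightarrow> 'b metric \<Rightarrow> bool" where
  "coarsely_equivalent X Y \<longleftrightarrow> (\<exists>f g. bornologous_map X Y f \<and> bornologous_map Y X g \<and>
     bdd_above ((\<lambda>x. mdist X (g (f x)) x) ` mspace X) \<and>
     bdd_above ((\<lambda>y. mdist Y (f (g y)) y) ` mspace Y))"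


section \<open>Entropy\<close>

definition eps_net :: "'a metric \<Rightarrow> real \<Rightarrow> 'a set \<Rightarrow> 'a set \<Rightarrow> bool" where
  "eps_net X \<epsilon> B N \<longleftrightarrow> N \<subseteq> B \<and> (\<forall>x\<in>B. \<exists>y\<in>N. mdist X x y < \<epsilon>)"

definition Ent :: "'a metric \<Rightarrow> real \<Rightarrow> 'a set \<Rightarrow> 'a rel" where
  "Ent X \<epsilon> B = card_Min {|N| |N. eps_net X \<epsilon> B N}"

definition Ent_ball :: "'a metric \<Rightarrow> real \<Rightarrow> real \<Rightarrow> 'a rel" where
  "Ent_ball X \<epsilon> \<delta> = card_Sup {Ent X \<epsilon> (mcball_of X x \<delta>) |x. x \<in> mspace X}"

text \<open>
  The library's \<open>cardSuc\<close> is the least larger cardinal also for finite arguments, where it adds one.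
\<close>

definition Ent_sharp_eps :: "'a metric \<Rightarrow> real \<Rightarrow> 'a set rel" where
  "Ent_sharp_eps X \<epsilon> = card_Sup {cardSuc (Ent_ball X \<epsilon> \<delta>) |\<delta>. 0 \<le> \<delta>}"

definition Ent_sharp :: "'a metric \<Rightarrow> 'a set rel" where
  "Ent_sharp X = card_Min {Ent_sharp_eps X \<epsilon> |\<epsilon>. 0 < \<epsilon>}"

lemma Ent_minimal:
  assumes "0 < \<epsilon>" "B \<subseteq> mspace X"
  shows "\<exists>N. eps_net X \<epsilon> B N \<and> Ent X \<epsilon> B = |N|" "eps_net X \<epsilon> B N \<Longrightarrow> Ent X \<epsilon> B \<le>o |N|"
proof -
  let ?R = "{|N| |N. eps_net X \<epsilon> B N}"
  have "\<exists>y\<in>B. mdist X x y < \<epsilon>" if "x \<in> B" for x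
  proof
    have "mdist X x x = 0" using that assms(2) by auto
    then show "mdist X x x < \<epsilon>" using assms(1) by linarith
  qed (rule that)
  then have "eps_net X \<epsilon> B B" by (auto simp: eps_net_def)
  then have ne: "?R \<noteq> {}" by blast
  have C: "\<And>r. r \<in> ?R \<Longrightarrow> Card_order r" by (auto simp: card_of_Card_order)
  show "\<exists>N. eps_net X \<epsilon> B N \<and> Ent X \<epsilon> B = |N|"
    using card_Min_in_least(1)[OF ne C] unfolding Ent_def by blast
  show "eps_net X \<epsilon> B N \<Longrightarrow> Ent X \<epsilon> B \<le>o |N|"
    using card_Min_in_least(2)[OF ne C, of "|N|"] unfolding Ent_def by blast
qed

lemma Card_order_Ent_ball: "0 < \<epsilon> \<Longrightarrow> Card_order (Ent_ball X \<epsilon> \<delta>)"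
proof -
  assume "0 < \<epsilon>"
  then have "Card_order (Ent X \<epsilon> (mcball_of X x \<delta>))" for x
    using Ent_minimal(1)[of \<epsilon> "mcball_of X x \<delta>" X] card_of_Card_order
    by (metis in_mcball_of subsetI)
  then show ?thesis unfolding Ent_ball_def by (intro card_Sup_Card_order) auto
qed

lemma Card_order_Ent_sharp_eps: "0 < \<epsilon> \<Longrightarrow> Card_order (Ent_sharp_eps X \<epsilon>)"
  unfolding Ent_sharp_eps_def
  by (intro card_Sup_Card_order) (auto intro: cardSuc_Card_order Card_order_Ent_ball)

lemma Ent_sharp_minimal:
  shows "\<exists>\<epsilon>>0. Ent_sharp X = Ent_sharp_eps X \<epsilon>" "0 < \<epsilon> \<Longrightarrow> Ent_sharp X \<le>o Ent_sharp_eps X \<epsilon>"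
proof -
  let ?R = "{Ent_sharp_eps X \<epsilon> |\<epsilon>. 0 < \<epsilon>}"
  have ne: "?R \<noteq> {}" using zero_less_one by blast
  have C: "\<And>r. r \<in> ?R \<Longrightarrow> Card_order r" by (auto intro: Card_order_Ent_sharp_eps)
  show "\<exists>\<epsilon>>0. Ent_sharp X = Ent_sharp_eps X \<epsilon>"
    using card_Min_in_least(1)[OF ne C] unfolding Ent_sharp_def by blast
  show "0 < \<epsilon> \<Longrightarrow> Ent_sharp X \<le>o Ent_sharp_eps X \<epsilon>"
    using card_Min_in_least(2)[OF ne C, of "Ent_sharp_eps X \<epsilon>"] unfolding Ent_sharp_def by blast
qed

end

theory Submission
  imports Defs
begin

text \<open>
  That sharp entropy is a coarse invariant needs no ultrametric: nets can be pulled back along a coarse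
  equivalence, at the price of a coarser scale (\<open>Ent_sharp_coarse_mono\<close>).

  For the converse, consider in a homogeneous ultrametric space the partitions into open balls of radii
  \<open>s 0 < s 1 < s 2\<close> and so on. By homogeneity each ball of one partition consists of the same number of balls of
  the preceding one, and the space is determined up to coarse equivalence by these numbers, which are cardinals. By
  passing to sparser scales they can be multiplied together. Equality of the sharp entropies is used only through
  one consequence (\<open>Ent_sharp_eq_balls_dominated\<close>): at all large scales, the number of small balls in any ball of one space is
  at most the number of small balls in some larger ball of the other space, and vice versa.

  The coarse equivalence is then built as a relation that interlocks a tower of partitions of \<open>X\<close>, at the even
  levels, with a tower of partitions of \<open>Y\<close>, at the odd levels: points in the same class of level \<open>n\<close> on one side are related
  only to points in the same class of level \<open>n + 1\<close> on the other. A class of level \<open>n + 1\<close> is linked with a family of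
  classes of level \<open>n\<close>. To proceed to the next level one has to distribute the classes of level
  \<open>n\<close> inside a class of level \<open>n + 2\<close> over a family of classes of level \<open>n + 1\<close>, in such a way that the families
  that arise as fibres are again of a size with which the construction can go on. The locale \<open>zigzag\<close> carries out
  the construction from this single requirement.

  The requirement is met in two ways. If the partitions are infinite, scales are chosen
  alternately in \<open>X\<close> and \<open>Y\<close> such that the numbers of pieces increase weakly, and
  \<open>\<kappa> * \<lambda> = \<kappa>\<close> for infinite \<open>\<kappa> \<ge> \<lambda> > 0\<close> provides the distributions (\<open>infinite_split\<close>, \<open>linked_infinite\<close>). If they are finite and
  the spaces are unbounded, the numbers of pieces may be coprime, as for powers of \<open>2\<close> and powers of \<open>3\<close>, so families of constant size are
  impossible; but with two consecutive admissible sizes and scales that grow fast enough the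
  rounding errors can be absorbed (\<open>finite_split\<close>, \<open>linked_finite\<close>). Bounded spaces, among them the empty
  one, are treated separately.
\<close>

section \<open>Comparing entropies\<close>

lemma mcball_subset_mspace: "mcball_of X x \<delta> \<subseteq> mspace X"
  by auto

lemma mdist_self [simp]: "x \<in> mspace X \<Longrightarrow> mdist X x x = 0"
  by simp

lemma Ent_net:
  assumes "0 < \<epsilon>" "B \<subseteq> mspace X"
  obtains N where "eps_net X \<epsilon> B N" "Ent X \<epsilon> B = |N|"
  using Ent_minimal(1)[OF assms] by metis

lemma Ent_Card_order: "0 < \<epsilon> \<Longrightarrow> B \<subseteq> mspace X \<Longrightarrow> Card_order (Ent X \<epsilon> B)"
  using Ent_minimal(1)[of \<epsilon> B X] card_of_Card_order by metis

lemma Ent_le_Ent_ball: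
  assumes "0 < \<epsilon>" "x \<in> mspace X"
  shows "Ent X \<epsilon> (mcball_of X x \<delta>) \<le>o Ent_ball X \<epsilon> \<delta>"
  unfolding Ent_ball_def
  by (rule card_Sup_upper) (use assms in \<open>auto intro: Ent_Card_order\<close>)

lemma Ent_ball_least:
  assumes "0 < \<epsilon>" "Card_order t" "\<And>x. x \<in> mspace X \<Longrightarrow> Ent X \<epsilon> (mcball_of X x \<delta>) \<le>o t"
  shows "Ent_ball X \<epsilon> \<delta> \<le>o t"
  unfolding Ent_ball_def
  by (rule card_Sup_least) (use assms in \<open>auto intro: Ent_Card_order\<close>)

lemma cardSuc_le_Ent_sharp_eps:
  assumes "0 < \<epsilon>" "0 \<le> \<delta>"
  shows "cardSuc (Ent_ball X \<epsilon> \<delta>) \<le>o Ent_sharp_eps X \<epsilon>"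
  unfolding Ent_sharp_eps_def
  by (rule card_Sup_upper) (use assms in \<open>auto intro: cardSuc_Card_order Card_order_Ent_ball\<close>)

lemma Ent_sharp_eps_least:
  assumes "0 < \<epsilon>" "Card_order t" "\<And>\<delta>. 0 \<le> \<delta> \<Longrightarrow> cardSuc (Ent_ball X \<epsilon> \<delta>) \<le>o t"
  shows "Ent_sharp_eps X \<epsilon> \<le>o t"
  unfolding Ent_sharp_eps_def
  by (rule card_Sup_least) (use assms in \<open>auto intro: cardSuc_Card_order Card_order_Ent_ball\<close>)

text \<open>
  Both suprema run over radii, so it suffices to dominate every ball of the first space, at its scale,
  by some ball of the second space at the other scale.
\<close>

lemma Ent_sharp_eps_le:
  fixes X :: "'a metric" and Y :: "'b metric"
  assumes "0 < \<epsilon>" "0 < \<epsilon>'"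
    and "\<And>\<delta>. 0 \<le> \<delta> \<Longrightarrow> \<exists>\<delta>'\<ge>0. Ent_ball X \<epsilon> \<delta> \<le>o Ent_ball Y \<epsilon>' \<delta>'"
  shows "Ent_sharp_eps X \<epsilon> \<le>o Ent_sharp_eps Y \<epsilon>'"
proof (rule Ent_sharp_eps_least[OF assms(1)])
  show "Card_order (Ent_sharp_eps Y \<epsilon>')" using assms(2) by (rule Card_order_Ent_sharp_eps)
  fix \<delta> :: real assume "0 \<le> \<delta>"
  then obtain \<delta>' where d': "\<delta>' \<ge> 0" "Ent_ball X \<epsilon> \<delta> \<le>o Ent_ball Y \<epsilon>' \<delta>'" using assms(3) by blast
  have "cardSuc (Ent_ball X \<epsilon> \<delta>) \<le>o cardSuc (Ent_ball Y \<epsilon>' \<delta>')"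
    using d'(2) assms(1,2) by (simp add: cardSuc_mono_ordLeq Card_order_Ent_ball)
  also have "cardSuc (Ent_ball Y \<epsilon>' \<delta>') \<le>o Ent_sharp_eps Y \<epsilon>'"
    by (rule cardSuc_le_Ent_sharp_eps[OF assms(2) d'(1)])
  finally show "cardSuc (Ent_ball X \<epsilon> \<delta>) \<le>o Ent_sharp_eps Y \<epsilon>'" .
qed

lemma Ent_sharp_eps_antimono:
  assumes "0 < \<epsilon>" "\<epsilon> \<le> \<epsilon>'"
  shows "Ent_sharp_eps X \<epsilon>' \<le>o Ent_sharp_eps X \<epsilon>"
proof (rule Ent_sharp_eps_le)
  have pos: "0 < \<epsilon>'" using assms by simp
  show "\<exists>\<delta>'\<ge>0. Ent_ball X \<epsilon>' \<delta> \<le>o Ent_ball X \<epsilon> \<delta>'" if "0 \<le> \<delta>" for \<delta>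
  proof (intro exI conjI)
    show "Ent_ball X \<epsilon>' \<delta> \<le>o Ent_ball X \<epsilon> \<delta>"
    proof (rule Ent_ball_least[OF pos Card_order_Ent_ball[OF assms(1)]])
      fix x assume x: "x \<in> mspace X"
      obtain N where N: "eps_net X \<epsilon> (mcball_of X x \<delta>) N" "Ent X \<epsilon> (mcball_of X x \<delta>) = |N|"
        by (rule Ent_net[OF assms(1) mcball_subset_mspace])
      have "eps_net X \<epsilon>' (mcball_of X x \<delta>) N"
        using N(1) assms(2) unfolding eps_net_def by (meson order_less_le_trans)
      then have "Ent X \<epsilon>' (mcball_of X x \<delta>) \<le>o Ent X \<epsilon> (mcball_of X x \<delta>)"
        unfolding N(2) by (rule Ent_minimal(2)[OF pos mcball_subset_mspace])
      also have "Ent X \<epsilon> (mcball_of X x \<delta>) \<le>o Ent_ball X \<epsilon> \<delta>"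
        by (rule Ent_le_Ent_ball[OF assms(1) x])
      finally show "Ent X \<epsilon>' (mcball_of X x \<delta>) \<le>o Ent_ball X \<epsilon> \<delta>" .
    qed
  qed (rule that)
qed (use assms in auto)

text \<open>
  A net at a fine scale is a net at every coarser scale, hence \<open>Ent_sharp_eps\<close> decreases with the scale,
  and once it has reached its minimum it stays there. From some scale on the sharp entropy can
  therefore be read off at whichever scale is convenient.
\<close>

lemma Ent_sharp_stable: "\<exists>\<epsilon>0>0. \<forall>\<epsilon>\<ge>\<epsilon>0. Ent_sharp_eps X \<epsilon> =o Ent_sharp X"
proof -
  obtain \<epsilon>0 where e: "\<epsilon>0 > 0" "Ent_sharp X = Ent_sharp_eps X \<epsilon>0" using Ent_sharp_minimal(1) by blast
  have "Ent_sharp_eps X \<epsilon> =o Ent_sharp X" if "\<epsilon> \<ge> \<epsilon>0" for \<epsilon>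
    using Ent_sharp_eps_antimono[OF e(1) that, of X] Ent_sharp_minimal(2)[of \<epsilon> X] e that
    by (simp add: ordIso_iff_ordLeq)
  then show ?thesis using e(1) by blast
qed

section \<open>Coarse invariance\<close>

text \<open>
  A net of a ball around \<open>f x\<close> pulls back along \<open>f\<close>: choose, for each net point that is close to some
  image \<open>f u\<close>, one such \<open>u\<close>. Points of the ball around \<open>x\<close> whose images are close to the same net point
  have images close to each other, and are therefore close themselves because \<open>g\<close> is bornologous and
  \<open>g \<circ> f\<close> is close to the identity.
\<close>

lemma Ent_sharp_coarse_mono:
  fixes X :: "'a metric" and Y :: "'b metric"
  assumes f: "bornologous_map X Y f" and g: "bornologous_map Y X g"
    and bdd: "bdd_above ((\<lambda>x. mdist X (g (f x)) x) ` mspace X)"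
  shows "Ent_sharp X \<le>o Ent_sharp Y"
proof -
  obtain \<epsilon> where e: "\<epsilon> > 0" "Ent_sharp Y = Ent_sharp_eps Y \<epsilon>" using Ent_sharp_minimal(1) by blast
  obtain K where K: "\<And>x. x \<in> mspace X \<Longrightarrow> mdist X (g (f x)) x \<le> K"
    using bdd unfolding bdd_above_def by auto
  obtain L where L: "\<And>y y'. y \<in> mspace Y \<Longrightarrow> y' \<in> mspace Y \<Longrightarrow> mdist Y y y' \<le> 2 * \<epsilon> \<Longrightarrow>
      mdist X (g y) (g y') \<le> L"
    using g unfolding bornologous_map_def by meson
  have fX: "f x \<in> mspace Y" if "x \<in> mspace X" for x using f that by (auto simp: bornologous_map_def)
  have gY: "g y \<in> mspace X" if "y \<in> mspace Y" for y using g that by (auto simp: bornologous_map_def)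
  \<comment> \<open>a move by \<open>K\<close> at either end and by \<open>L\<close> in between; the summand \<open>1\<close> makes the bound strict\<close>
  define \<epsilon>' where "\<epsilon>' = \<bar>L\<bar> + 2 * \<bar>K\<bar> + 1"
  have e': "0 < \<epsilon>'" by (simp add: \<epsilon>'_def add_nonneg_pos)
  have near: "mdist X x x' < \<epsilon>'"
    if x: "x \<in> mspace X" "x' \<in> mspace X" and d: "mdist Y (f x) (f x') \<le> 2 * \<epsilon>" for x x'
  proof -
    have "mdist X x x' \<le> mdist X x (g (f x)) + mdist X (g (f x)) x'"
      using x fX gY mdist_triangle by metis
    also have "mdist X (g (f x)) x' \<le> mdist X (g (f x)) (g (f x')) + mdist X (g (f x')) x'"
      using x fX gY mdist_triangle by metis
    finally show ?thesis
      using K[OF x(1)] K[OF x(2)] L[OF fX[OF x(1)] fX[OF x(2)] d] mdist_commute[of X x "g (f x)"]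
      unfolding \<epsilon>'_def by linarith
  qed
  have "Ent_sharp_eps X \<epsilon>' \<le>o Ent_sharp_eps Y \<epsilon>"
  proof (rule Ent_sharp_eps_le[OF e' e(1)])
    fix \<delta> :: real assume "0 \<le> \<delta>"
    obtain \<delta>1 where d1: "\<And>x x'. x \<in> mspace X \<Longrightarrow> x' \<in> mspace X \<Longrightarrow> mdist X x x' \<le> \<delta> \<Longrightarrow>
        mdist Y (f x) (f x') \<le> \<delta>1"
      using f unfolding bornologous_map_def by meson
    define \<delta>' where "\<delta>' = max \<delta>1 0"
    have "Ent_ball X \<epsilon>' \<delta> \<le>o Ent_ball Y \<epsilon> \<delta>'"
    proof (rule Ent_ball_least[OF e' Card_order_Ent_ball[OF e(1)]])
      fix x assume x: "x \<in> mspace X"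
      obtain N where N: "eps_net Y \<epsilon> (mcball_of Y (f x) \<delta>') N" "Ent Y \<epsilon> (mcball_of Y (f x) \<delta>') = |N|"
        by (rule Ent_net[OF e(1) mcball_subset_mspace])
      define N0 where "N0 = {n \<in> N. \<exists>u \<in> mcball_of X x \<delta>. mdist Y (f u) n < \<epsilon>}"
      have "\<forall>n\<in>N0. \<exists>u. u \<in> mcball_of X x \<delta> \<and> mdist Y (f u) n < \<epsilon>"
        unfolding N0_def by blast
      from bchoice[OF this] obtain p
        where p: "\<And>n. n \<in> N0 \<Longrightarrow> p n \<in> mcball_of X x \<delta> \<and> mdist Y (f (p n)) n < \<epsilon>" by blast
      have "\<exists>y\<in>p ` N0. mdist X u y < \<epsilon>'" if u: "u \<in> mcball_of X x \<delta>" for u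
      proof -
        have "f u \<in> mcball_of Y (f x) \<delta>'"
          using u x fX d1[of x u] by (auto simp: \<delta>'_def)
        then obtain n where n: "n \<in> N" "mdist Y (f u) n < \<epsilon>" using N(1) unfolding eps_net_def by blast
        then have n0: "n \<in> N0" using u by (auto simp: N0_def)
        have "n \<in> mspace Y" using n(1) N(1) by (auto simp: eps_net_def)
        moreover have pX: "p n \<in> mspace X" "u \<in> mspace X" using p[OF n0] u by auto
        ultimately have "mdist Y (f u) (f (p n)) \<le> mdist Y (f u) n + mdist Y n (f (p n))"
          using fX mdist_triangle by metis
        then have "mdist Y (f u) (f (p n)) \<le> 2 * \<epsilon>"
          using n(2) p[OF n0] mdist_commute[of Y n "f (p n)"] by linarith
        then show ?thesis using near pX n0 by blast
      qed
      then have "eps_net X \<epsilon>' (mcball_of X x \<delta>) (p ` N0)" using p unfolding eps_net_def by blast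
      then have "Ent X \<epsilon>' (mcball_of X x \<delta>) \<le>o |p ` N0|"
        by (rule Ent_minimal(2)[OF e' mcball_subset_mspace])
      also have "|p ` N0| \<le>o |N0|" by (rule card_of_image)
      also have "|N0| \<le>o |N|" by (rule card_of_mono1) (auto simp: N0_def)
      also have "|N| \<le>o Ent_ball Y \<epsilon> \<delta>'"
        using Ent_le_Ent_ball[OF e(1) fX[OF x]] unfolding N(2)[symmetric] .
      finally show "Ent X \<epsilon>' (mcball_of X x \<delta>) \<le>o Ent_ball Y \<epsilon> \<delta>'" .
    qed
    then show "\<exists>\<delta>'\<ge>0. Ent_ball X \<epsilon>' \<delta> \<le>o Ent_ball Y \<epsilon> \<delta>'" by (intro exI[of _ \<delta>']) (simp add: \<delta>'_def)
  qed
  with Ent_sharp_minimal(2)[OF e', of X] show ?thesis unfolding e(2) by (rule ordLeq_transitive)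
qed

section \<open>Equal sharp entropy means mutual domination of balls\<close>

text \<open>
  If no \<open>Ent_ball Y \<epsilon>' \<delta>'\<close> were at least \<open>\<kappa> = Ent_ball X \<epsilon> \<delta>\<close>, then all the successors
  \<open>(Ent_ball Y \<epsilon>' \<delta>')\<^sup>+\<close> would be at most \<open>\<kappa>\<close>, and so would their supremum, which is at least
  \<open>\<kappa>\<^sup>+\<close>. This is where it matters that the sharp entropy is built from successors: it tells
  a supremum that is attained from one that is only approached, and spares a distinction between
  successor and limit cardinals.
\<close>

lemma Ent_ball_dominated:
  fixes X :: "'a metric" and Y :: "'b metric"
  assumes "0 < \<epsilon>" "0 < \<epsilon>'" "Ent_sharp_eps X \<epsilon> \<le>o Ent_sharp_eps Y \<epsilon>'" "0 \<le> \<delta>"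
  shows "\<exists>\<delta>'\<ge>0. Ent_ball X \<epsilon> \<delta> \<le>o Ent_ball Y \<epsilon>' \<delta>'"
proof (rule ccontr)
  assume neg: "\<not> ?thesis"
  note CX = Card_order_Ent_ball[OF assms(1), of X \<delta>]
  have "Ent_sharp_eps Y \<epsilon>' \<le>o Ent_ball X \<epsilon> \<delta>"
  proof (rule Ent_sharp_eps_least[OF assms(2) CX])
    fix \<delta>' :: real assume "0 \<le> \<delta>'"
    then have "\<not> Ent_ball X \<epsilon> \<delta> \<le>o Ent_ball Y \<epsilon>' \<delta>'" using neg by blast
    then have "Ent_ball Y \<epsilon>' \<delta>' <o Ent_ball X \<epsilon> \<delta>"
      using CX Card_order_Ent_ball[OF assms(2), of Y \<delta>']
      by (simp add: not_ordLeq_iff_ordLess card_order_on_well_order_on)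
    then show "cardSuc (Ent_ball Y \<epsilon>' \<delta>') \<le>o Ent_ball X \<epsilon> \<delta>"
      by (intro cardSuc_least Card_order_Ent_ball CX assms)
  qed
  with assms(3) have "Ent_sharp_eps X \<epsilon> \<le>o Ent_ball X \<epsilon> \<delta>" by (rule ordLeq_transitive)
  with cardSuc_le_Ent_sharp_eps[OF assms(1,4), of X]
  have "cardSuc (Ent_ball X \<epsilon> \<delta>) \<le>o Ent_ball X \<epsilon> \<delta>" by (rule ordLeq_transitive)
  then show False using cardSuc_greater[OF CX] not_ordLess_ordLeq by blast
qed

lemma Ent_sharp_eq_dominated:
  fixes X :: "'a metric" and Y :: "'b metric"
  assumes "Ent_sharp X =o Ent_sharp Y"
  shows "\<exists>\<epsilon>0>0. \<forall>\<epsilon>\<ge>\<epsilon>0. \<forall>\<epsilon>'\<ge>\<epsilon>0. \<forall>\<delta>\<ge>0. \<exists>\<delta>'\<ge>0. Ent_ball X \<epsilon> \<delta> \<le>o Ent_ball Y \<epsilon>' \<delta>'"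
proof -
  obtain a where a: "a > 0" "\<And>\<epsilon>. \<epsilon> \<ge> a \<Longrightarrow> Ent_sharp_eps X \<epsilon> =o Ent_sharp X"
    using Ent_sharp_stable by blast
  obtain b where b: "b > 0" "\<And>\<epsilon>. \<epsilon> \<ge> b \<Longrightarrow> Ent_sharp_eps Y \<epsilon> =o Ent_sharp Y"
    using Ent_sharp_stable by blast
  have "\<exists>\<delta>'\<ge>0. Ent_ball X \<epsilon> \<delta> \<le>o Ent_ball Y \<epsilon>' \<delta>'"
    if "\<epsilon> \<ge> max a b" "\<epsilon>' \<ge> max a b" "\<delta> \<ge> 0" for \<epsilon> \<epsilon>' \<delta>
  proof (rule Ent_ball_dominated)
    have X: "Ent_sharp_eps X \<epsilon> =o Ent_sharp X" by (rule a(2)) (use that in simp)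
    have Y: "Ent_sharp_eps Y \<epsilon>' =o Ent_sharp Y" by (rule b(2)) (use that in simp)
    have "Ent_sharp_eps X \<epsilon> =o Ent_sharp_eps Y \<epsilon>'"
      by (rule ordIso_transitive[OF ordIso_transitive[OF X assms] ordIso_symmetric[OF Y]])
    then show "Ent_sharp_eps X \<epsilon> \<le>o Ent_sharp_eps Y \<epsilon>'" by (rule ordIso_imp_ordLeq)
  qed (use a(1) b(1) that in auto)
  then have "\<forall>\<epsilon>\<ge>max a b. \<forall>\<epsilon>'\<ge>max a b. \<forall>\<delta>\<ge>0. \<exists>\<delta>'\<ge>0. Ent_ball X \<epsilon> \<delta> \<le>o Ent_ball Y \<epsilon>' \<delta>'"
    by (intro allI impI)
  moreover have "max a b > 0" using a(1) by simp
  ultimately show ?thesis by (intro exI[of _ "max a b"] conjI)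
qed

section \<open>Balls in ultrametric spaces\<close>

definition balls :: "'a metric \<Rightarrow> real \<Rightarrow> 'a set \<Rightarrow> 'a set set" where
  "balls X s B = (\<lambda>x. mball_of X x s) ` B"

lemma ultrametric_less:
  assumes "ultrametric X" "x \<in> mspace X" "y \<in> mspace X" "z \<in> mspace X" "mdist X x y < s" "mdist X y z < s"
  shows "mdist X x z < s"
  using assms unfolding ultrametric_def by (metis le_less_trans max_less_iff_conj)

lemma mball_eq:
  assumes "ultrametric X" "x \<in> mspace X" "y \<in> mspace X" "mdist X x y < s"
  shows "mball_of X x s = mball_of X y s"
proof -
  have "mdist X y x < s" using assms(4) by (simp add: mdist_commute)
  then have "mdist X x v < s \<longleftrightarrow> mdist X y v < s" if "v \<in> mspace X" for v
    using ultrametric_less[OF assms(1)] assms(2-4) that by blast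
  then show ?thesis using assms(2,3) by auto
qed

text \<open>
  In an ultrametric space the open balls of radius \<open>s\<close> partition the space. A net of scale \<open>s\<close> has to
  meet every ball of the partition with a centre in \<open>B\<close>, and one point in each of them is enough.
\<close>

lemma Ent_card_balls:
  assumes "ultrametric X" "0 < s" "B \<subseteq> mspace X"
  shows "Ent X s B =o |balls X s B|"
proof -
  obtain N where N: "eps_net X s B N" "Ent X s B = |N|" by (rule Ent_net[OF assms(2,3)])
  have "balls X s B \<subseteq> (\<lambda>x. mball_of X x s) ` N"
  proof
    fix b assume "b \<in> balls X s B"
    then obtain x where x: "x \<in> B" "b = mball_of X x s" by (auto simp: balls_def)
    then obtain y where "y \<in> N" "mdist X x y < s" using N(1) by (auto simp: eps_net_def)
    moreover from this have "y \<in> B" using N(1) by (auto simp: eps_net_def)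
    ultimately show "b \<in> (\<lambda>x. mball_of X x s) ` N"
      using x mball_eq[OF assms(1), of x y s] assms(3) by blast
  qed
  then have ge: "|balls X s B| \<le>o Ent X s B" unfolding N(2) by (rule surj_imp_ordLeq)
  have "\<forall>b\<in>balls X s B. \<exists>x. x \<in> B \<and> mball_of X x s = b" unfolding balls_def by blast
  from bchoice[OF this] obtain p
    where p: "\<And>b. b \<in> balls X s B \<Longrightarrow> p b \<in> B \<and> mball_of X (p b) s = b" by blast
  have "eps_net X s B (p ` balls X s B)"
    unfolding eps_net_def
  proof (intro conjI ballI)
    show "p ` balls X s B \<subseteq> B" using p by auto
    fix x assume x: "x \<in> B"
    let ?b = "mball_of X x s"
    have b: "?b \<in> balls X s B" using x by (auto simp: balls_def)
    have "x \<in> ?b" using subsetD[OF assms(3) x] assms(2) by simp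
    moreover have "mball_of X (p ?b) s = ?b" using p[OF b] ..
    ultimately have "x \<in> mball_of X (p ?b) s" by blast
    then have "mdist X x (p ?b) < s" using mdist_commute[of X x "p ?b"] by simp
    then show "\<exists>y\<in>p ` balls X s B. mdist X x y < s" using b by blast
  qed
  then have "Ent X s B \<le>o |p ` balls X s B|" by (rule Ent_minimal(2)[OF assms(2,3)])
  also have "|p ` balls X s B| \<le>o |balls X s B|" by (rule card_of_image)
  finally show ?thesis using ge by (simp add: ordIso_iff_ordLeq)
qed

lemma isometry_image_mball:
  assumes f: "bij_betw f (mspace X) (mspace X)"
      "\<And>u v. u \<in> mspace X \<Longrightarrow> v \<in> mspace X \<Longrightarrow> mdist X (f u) (f v) = mdist X u v"
    and u: "u \<in> mspace X"
  shows "f ` mball_of X u s = mball_of X (f u) s"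
proof
  have fX: "f v \<in> mspace X" if "v \<in> mspace X" for v using bij_betwE[OF f(1)] that by blast
  then show "f ` mball_of X u s \<subseteq> mball_of X (f u) s" using f(2) u by auto
  show "mball_of X (f u) s \<subseteq> f ` mball_of X u s"
  proof
    fix v assume v: "v \<in> mball_of X (f u) s"
    then obtain w where w: "w \<in> mspace X" "v = f w" using f(1) by (auto simp: bij_betw_def)
    then have "w \<in> mball_of X u s" using v f(2)[OF u w(1)] u by simp
    then show "v \<in> f ` mball_of X u s" using w(2) by blast
  qed
qed

lemma homogeneous_balls:
  assumes "homogeneous_metric X" "x \<in> mspace X" "y \<in> mspace X"
  shows "|balls X s (mball_of X x t)| =o |balls X s (mball_of X y t)|"
proof -
  have "|balls X s (mball_of X y t)| \<le>o |balls X s (mball_of X x t)|"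
    if "x \<in> mspace X" "y \<in> mspace X" for x y
  proof -
    have "\<exists>f. bij_betw f (mspace X) (mspace X) \<and>
      (\<forall>u\<in>mspace X. \<forall>v\<in>mspace X. mdist X (f u) (f v) = mdist X u v) \<and> f x = y"
      using assms(1) that unfolding homogeneous_metric_def by simp
    then obtain f where f: "bij_betw f (mspace X) (mspace X)"
      "\<And>u v. u \<in> mspace X \<Longrightarrow> v \<in> mspace X \<Longrightarrow> mdist X (f u) (f v) = mdist X u v" "f x = y"
      by auto
    have im: "f ` mball_of X u r = mball_of X (f u) r" if "u \<in> mspace X" for u r
      by (rule isometry_image_mball[OF f(1) _ that]) (rule f(2))
    have "balls X s (mball_of X y t) = balls X s (f ` mball_of X x t)"
      using im[OF that(1), of t] f(3) by simp
    also have "\<dots> = (\<lambda>u. mball_of X (f u) s) ` mball_of X x t"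
      by (simp add: balls_def image_image)
    also have "\<dots> = (\<lambda>u. f ` mball_of X u s) ` mball_of X x t"
      by (intro image_cong refl im[symmetric]) auto
    also have "\<dots> = (`) f ` balls X s (mball_of X x t)"
      by (simp add: balls_def image_image)
    finally show ?thesis by (simp add: card_of_image)
  qed
  then show ?thesis using assms(2,3) by (simp add: ordIso_iff_ordLeq)
qed

lemma balls_mono: "B \<subseteq> C \<Longrightarrow> |balls X s B| \<le>o |balls X s C|"
  unfolding balls_def by (intro card_of_mono1 image_mono)

text \<open>
  The domination in the form in which it is used below: with actual partitions into balls in place of
  cardinal suprema. By homogeneity the centres do not matter.
\<close>

lemma Ent_sharp_eq_balls_dominated:
  fixes X :: "'a metric" and Y :: "'b metric"
  assumes "Ent_sharp X =o Ent_sharp Y" "ultrametric X" "ultrametric Y" "homogeneous_metric Y"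
  shows "\<exists>\<epsilon>0>0. \<forall>s\<ge>\<epsilon>0. \<forall>s'\<ge>\<epsilon>0. \<forall>t. \<exists>t'. \<forall>x\<in>mspace X. \<forall>y\<in>mspace Y.
    |balls X s (mball_of X x t)| \<le>o |balls Y s' (mball_of Y y t')|"
proof -
  obtain \<epsilon>0 where e: "\<epsilon>0 > 0" "\<And>s s' \<delta>. s \<ge> \<epsilon>0 \<Longrightarrow> s' \<ge> \<epsilon>0 \<Longrightarrow> \<delta> \<ge> 0 \<Longrightarrow>
      \<exists>\<delta>'\<ge>0. Ent_ball X s \<delta> \<le>o Ent_ball Y s' \<delta>'"
    using Ent_sharp_eq_dominated[OF assms(1)] by meson
  have "\<exists>t'. \<forall>x\<in>mspace X. \<forall>y\<in>mspace Y.
    |balls X s (mball_of X x t)| \<le>o |balls Y s' (mball_of Y y t')|" if s: "s \<ge> \<epsilon>0" "s' \<ge> \<epsilon>0" for s s' t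
  proof -
    obtain \<delta>' where d: "Ent_ball X s (max t 0) \<le>o Ent_ball Y s' \<delta>'" using e(2)[OF s, of "max t 0"] by auto
    have pos: "s > 0" "s' > 0" using e(1) s by auto
    have "|balls X s (mball_of X x t)| \<le>o |balls Y s' (mball_of Y y (\<delta>' + 1))|"
      if x: "x \<in> mspace X" and y: "y \<in> mspace Y" for x y
    proof -
      have "|balls X s (mball_of X x t)| \<le>o |balls X s (mcball_of X x (max t 0))|"
        by (intro balls_mono) auto
      also have "|balls X s (mcball_of X x (max t 0))| =o Ent X s (mcball_of X x (max t 0))"
        by (rule ordIso_symmetric) (intro Ent_card_balls assms pos mcball_subset_mspace)
      also have "Ent X s (mcball_of X x (max t 0)) \<le>o Ent_ball X s (max t 0)"
        by (intro Ent_le_Ent_ball pos x)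
      also note d
      also have "Ent_ball Y s' \<delta>' \<le>o |balls Y s' (mball_of Y y (\<delta>' + 1))|"
      proof (rule Ent_ball_least[OF pos(2) card_of_Card_order])
        fix z assume z: "z \<in> mspace Y"
        have "Ent Y s' (mcball_of Y z \<delta>') =o |balls Y s' (mcball_of Y z \<delta>')|"
          by (intro Ent_card_balls assms pos mcball_subset_mspace)
        also have "|balls Y s' (mcball_of Y z \<delta>')| \<le>o |balls Y s' (mball_of Y z (\<delta>' + 1))|"
          by (intro balls_mono) auto
        also have "|balls Y s' (mball_of Y z (\<delta>' + 1))| =o |balls Y s' (mball_of Y y (\<delta>' + 1))|"
          by (intro homogeneous_balls assms z y)
        finally show "Ent Y s' (mcball_of Y z \<delta>') \<le>o |balls Y s' (mball_of Y y (\<delta>' + 1))|" .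
      qed
      finally show ?thesis .
    qed
    then show ?thesis by blast
  qed
  then show ?thesis using e(1) by blast
qed

lemma Ent_sharp_eq_empty:
  fixes X :: "'a metric" and Y :: "'b metric"
  assumes "Ent_sharp X =o Ent_sharp Y" "mspace Y = {}"
  shows "mspace X = {}"
proof (rule ccontr)
  assume "mspace X \<noteq> {}"
  then obtain x where x: "x \<in> mspace X" by blast
  obtain \<epsilon>0 where e: "\<epsilon>0 > 0" "\<And>s s' \<delta>. s \<ge> \<epsilon>0 \<Longrightarrow> s' \<ge> \<epsilon>0 \<Longrightarrow> \<delta> \<ge> 0 \<Longrightarrow>
      \<exists>\<delta>'\<ge>0. Ent_ball X s \<delta> \<le>o Ent_ball Y s' \<delta>'"
    using Ent_sharp_eq_dominated[OF assms(1)] by meson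
  then obtain \<delta>' where d: "Ent_ball X \<epsilon>0 0 \<le>o Ent_ball Y \<epsilon>0 \<delta>'" by (meson order_refl)
  obtain N where N: "eps_net X \<epsilon>0 (mcball_of X x 0) N" "Ent X \<epsilon>0 (mcball_of X x 0) = |N|"
    by (rule Ent_net[OF e(1) mcball_subset_mspace])
  have "|N| \<le>o Ent_ball X \<epsilon>0 0" using Ent_le_Ent_ball[OF e(1) x] N(2) by metis
  also note d
  also have "Ent_ball Y \<epsilon>0 \<delta>' \<le>o |{}::'a set|"
    by (rule Ent_ball_least[OF e(1) card_of_Card_order]) (simp add: assms(2))
  finally have "N = {}" by (simp add: card_of_empty3)
  moreover have "x \<in> mcball_of X x 0" using x by simp
  ultimately show False using N(1) by (auto simp: eps_net_def)
qed

section \<open>Linking two towers of partitions\<close>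

text \<open>
  Two sets, \<open>S 0\<close> and \<open>S 1\<close>, each carry an increasing tower of equivalence relations. The levels
  alternate: \<open>r 0\<close>, \<open>r 2\<close> and so on live on \<open>S 0\<close>, and \<open>r 1\<close>, \<open>r 3\<close> and so on live on \<open>S 1\<close>. The
  aim is a symmetric relation between the two sets that carries \<open>r i\<close> into \<open>r (i + 1)\<close> for every \<open>i\<close>:
  then the two towers control each other, one level up.

  Such a relation matches an \<open>r (n + 1)\<close>-class on one side with a whole family \<open>J\<close> of \<open>r n\<close>-classes on
  the other side. The predicate \<open>G n\<close> says which families are of an admissible size. The
  assumption \<open>split\<close> is the only one about cardinalities: the \<open>r n\<close>-classes inside an
  \<open>r (n + 2)\<close>-class \<open>C\<close> can be distributed over any admissible family of \<open>r (n + 1)\<close>-classes so that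
  each of these receives an admissible family. Moreover one fibre \<open>A0\<close> can be prescribed
  before the family \<open>J\<close> is known; this allows a relation that is already constructed on a part of
  the two sets to be extended.
\<close>

locale zigzag =
  fixes S :: "nat \<Rightarrow> 'c set" and r :: "nat \<Rightarrow> 'c rel" and G :: "nat \<Rightarrow> 'c set set \<Rightarrow> bool"
  assumes S_step: "S (Suc (Suc n)) = S n"
    and S_disjoint: "S 0 \<inter> S (Suc 0) = {}"
    and S_nonempty: "S n \<noteq> {}"
    and equiv_r: "equiv (S n) (r n)"
    and r_step: "r n \<subseteq> r (Suc (Suc n))"
    and exhaust: "\<lbrakk>x \<in> S n; y \<in> S n\<rbrakk> \<Longrightarrow> \<exists>m. (x, y) \<in> r (n + 2 * m)"
    and G_nonempty: "G n J \<Longrightarrow> J \<noteq> {}"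
    and split: "\<lbrakk>C \<in> S (Suc (Suc n)) // r (Suc (Suc n)); a0 \<in> S n // r n; a0 \<subseteq> C\<rbrakk> \<Longrightarrow>
      \<exists>A0. a0 \<in> A0 \<and> A0 \<subseteq> {a \<in> S n // r n. a \<subseteq> C} \<and> G n A0 \<and>
        (\<forall>J j0. J \<subseteq> S (Suc n) // r (Suc n) \<longrightarrow> G (Suc n) J \<longrightarrow> j0 \<in> J \<longrightarrow>
          (\<exists>h \<in> {a \<in> S n // r n. a \<subseteq> C} \<rightarrow> J.
             (\<forall>j\<in>J. G n {a \<in> S n // r n. a \<subseteq> C \<and> h a = j}) \<and>
             {a \<in> S n // r n. a \<subseteq> C \<and> h a = j0} = A0))"
begin

lemma S_parity: "S n = S (n mod 2)"
proof (induction n rule: less_induct)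
  case (less n)
  show ?case
  proof (cases "n < 2")
    case False
    then obtain k where "n = Suc (Suc k)" by (metis add_2_eq_Suc le_iff_add not_less)
    with less[of k] S_step[of k] show ?thesis by simp
  qed simp
qed

lemma same_parity: "u \<in> S m \<Longrightarrow> u \<in> S n \<Longrightarrow> even m = even n"
  using S_disjoint S_parity[of m] S_parity[of n]
  by (cases "even m"; cases "even n") (auto simp: even_iff_mod_2_eq_zero odd_iff_mod_2_eq_one)

lemma r_subset: "r n \<subseteq> S n \<times> S n"
  using equiv_r[of n] by (simp add: equiv_def)

lemma r_mono:
  assumes "m \<le> n" "even m = even n" shows "r m \<subseteq> r n"
proof -
  have "r m \<subseteq> r (m + 2 * k)" for k
    by (induction k) (use r_step in auto)
  moreover have "n = m + 2 * ((n - m) div 2)" using assms by presburger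
  ultimately show ?thesis by metis
qed

lemma r_mono_at:
  assumes "(u, v) \<in> r m" "u \<in> S n" "m \<le> n" shows "(u, v) \<in> r n"
  using r_mono[OF \<open>m \<le> n\<close>] same_parity[OF _ \<open>u \<in> S n\<close>, of m] assms r_subset by blast

lemma same_class:
  assumes "a \<in> S n // r n" "b \<in> S n // r n" "u \<in> a" "v \<in> b" "(u, v) \<in> r n"
  shows "a = b"
  using quotient_eq_iff[OF equiv_r assms(1-4)] assms(5) by blast

lemma in_class_rel: "a \<in> S n // r n \<Longrightarrow> u \<in> a \<Longrightarrow> v \<in> a \<Longrightarrow> (u, v) \<in> r n"
  using equiv_r quotient_eq_iff by metis

lemma class_subset: "a \<in> S n // r n \<Longrightarrow> a \<subseteq> S n"
  using equiv_r in_quotient_imp_subset by metis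

lemma Union_classes:
  assumes "C \<in> S (Suc (Suc n)) // r (Suc (Suc n))"
  shows "\<Union>{a \<in> S n // r n. a \<subseteq> C} = C"
proof
  show "C \<subseteq> \<Union>{a \<in> S n // r n. a \<subseteq> C}"
  proof
    fix u assume u: "u \<in> C"
    then have uS: "u \<in> S n" using class_subset[OF assms] S_step by auto
    have "r n `` {u} \<subseteq> C"
    proof
      fix v assume "v \<in> r n `` {u}"
      then have "(u, v) \<in> r (Suc (Suc n))" using r_step by auto
      then show "v \<in> C"
        using assms u equiv_r in_quotient_imp_closed by metis
    qed
    moreover have "u \<in> r n `` {u}" using equiv_r uS equiv_class_self by metis
    moreover have "r n `` {u} \<in> S n // r n" using uS by (rule quotientI)
    ultimately show "u \<in> \<Union>{a \<in> S n // r n. a \<subseteq> C}" by blast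
  qed
qed auto

definition controlled :: "'c rel \<Rightarrow> bool" where
  "controlled R \<longleftrightarrow> (\<forall>i u v u' v'. (u, v) \<in> R \<longrightarrow> (u', v') \<in> R \<longrightarrow> (u, u') \<in> r i \<longrightarrow> (v, v') \<in> r (Suc i))"

lemma controlledD:
  "controlled R \<Longrightarrow> (u, v) \<in> R \<Longrightarrow> (u', v') \<in> R \<Longrightarrow> (u, u') \<in> r i \<Longrightarrow> (v, v') \<in> r (Suc i)"
  unfolding controlled_def by metis

definition links :: "'c rel \<Rightarrow> 'c set \<Rightarrow> 'c set \<Rightarrow> bool" where
  "links R D U \<longleftrightarrow> sym R \<and> R \<subseteq> D \<times> U \<union> U \<times> D \<and> Domain R = D \<union> U \<and> controlled R"

text \<open>
  The inductive step. Each \<open>r (n + 1)\<close>-class \<open>j\<close> of \<open>J\<close> is linked with the \<open>r n\<close>-classes that \<open>h\<close> sends to it;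
  the union of these links relates \<open>C\<close> to \<open>\<Union>J\<close>. Control can only be lost between points that belong to
  different links. Such points are inequivalent at level \<open>n\<close> in \<open>C\<close> and at level \<open>n + 1\<close> in \<open>\<Union>J\<close>, so
  that there is nothing to check at low levels; and at the remaining levels the conclusion holds because
  \<open>C\<close> and \<open>\<Union>J\<close> each lie in one class.
\<close>

lemma links_glue:
  assumes C: "C \<in> S (Suc (Suc n)) // r (Suc (Suc n))"
    and J: "J \<subseteq> S (Suc n) // r (Suc n)"
    and close: "\<And>v v'. v \<in> \<Union>J \<Longrightarrow> v' \<in> \<Union>J \<Longrightarrow> (v, v') \<in> r (Suc (Suc (Suc n)))"
    and h: "h \<in> {a \<in> S n // r n. a \<subseteq> C} \<rightarrow> J"
    and T: "\<And>j. j \<in> J \<Longrightarrow> links (T j) j (\<Union>{a \<in> S n // r n. a \<subseteq> C \<and> h a = j})"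
  shows "links (\<Union>j\<in>J. T j) C (\<Union>J)"
proof -
  define F where "F j = \<Union>{a \<in> S n // r n. a \<subseteq> C \<and> h a = j}" for j
  have T': "sym (T j)" "T j \<subseteq> j \<times> F j \<union> F j \<times> j" "Domain (T j) = j \<union> F j" "controlled (T j)"
    if "j \<in> J" for j using T[OF that] by (auto simp: links_def F_def)
  have FC: "F j \<subseteq> C" for j by (auto simp: F_def)
  have CS: "C \<subseteq> S (Suc (Suc n))" using class_subset[OF C] .
  have JS: "j \<subseteq> S (Suc n)" if "j \<in> J" for j using class_subset J that by auto
  have "C \<subseteq> (\<Union>j\<in>J. F j)"
  proof
    fix u assume "u \<in> C"
    then obtain a where "a \<in> S n // r n" "a \<subseteq> C" "u \<in> a" using Union_classes[OF C] by blast
    moreover from this have "h a \<in> J" using h by blast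
    ultimately show "u \<in> (\<Union>j\<in>J. F j)" by (auto simp: F_def)
  qed
  then have FJ: "(\<Union>j\<in>J. F j) = C" using FC by blast
  have "Domain (\<Union>j\<in>J. T j) = (\<Union>j\<in>J. Domain (T j))" by blast
  also have "\<dots> = (\<Union>j\<in>J. j \<union> F j)" using T'(3) by simp
  also have "\<dots> = C \<union> \<Union>J" using FJ by blast
  finally have dom: "Domain (\<Union>j\<in>J. T j) = C \<union> \<Union>J" .
  have sub: "(\<Union>j\<in>J. T j) \<subseteq> C \<times> \<Union>J \<union> \<Union>J \<times> C"
    using T'(2) FC by blast
  have "controlled (\<Union>j\<in>J. T j)"
    unfolding controlled_def
  proof (intro allI impI)
    fix i u v u' v'
    assume "(u, v) \<in> (\<Union>j\<in>J. T j)" "(u', v') \<in> (\<Union>j\<in>J. T j)" and uu: "(u, u') \<in> r i"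
    then obtain j j' where j: "j \<in> J" "(u, v) \<in> T j" and j': "j' \<in> J" "(u', v') \<in> T j'" by blast
    have uSi: "u \<in> S i" "u' \<in> S i" using uu r_subset by blast+
    show "(v, v') \<in> r (Suc i)"
    proof (cases "j = j'")
      case True
      then show ?thesis using T'(4)[OF j(1)] j(2) j'(2) uu unfolding controlled_def by blast
    next
      case False
      have "u \<in> j \<and> v \<in> F j \<or> u \<in> F j \<and> v \<in> j" using T'(2)[OF j(1)] j(2) by blast
      moreover have "u' \<in> j' \<and> v' \<in> F j' \<or> u' \<in> F j' \<and> v' \<in> j'" using T'(2)[OF j'(1)] j'(2) by blast
      moreover have "\<not> (u \<in> j \<and> u' \<in> F j')"
      proof
        assume "u \<in> j \<and> u' \<in> F j'"
        then have "u \<in> S (Suc n)" "u' \<in> S (Suc (Suc n))" using JS j(1) FC CS by blast+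
        then have "even i = even (Suc n)" "even i = even (Suc (Suc n))"
          using same_parity uSi by blast+
        then show False by simp
      qed
      moreover have "\<not> (u \<in> F j \<and> u' \<in> j')"
      proof
        assume "u \<in> F j \<and> u' \<in> j'"
        then have "u' \<in> S (Suc n)" "u \<in> S (Suc (Suc n))" using JS j'(1) FC CS by blast+
        then have "even i = even (Suc n)" "even i = even (Suc (Suc n))"
          using same_parity uSi by blast+
        then show False by simp
      qed
      ultimately consider "u \<in> j" "v \<in> F j" "u' \<in> j'" "v' \<in> F j'"
        | "u \<in> F j" "v \<in> j" "u' \<in> F j'" "v' \<in> j'" by blast
      then show ?thesis
      proof cases
        \<comment> \<open>the first coordinates lie in different classes of \<open>J\<close>\<close>
        case 1
        have uS: "u \<in> S (Suc n)" using 1 JS j(1) by blast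
        have "\<not> i \<le> Suc n"
        proof
          assume "i \<le> Suc n"
          then have "(u, u') \<in> r (Suc n)" using r_mono_at[OF uu uS] by blast
          then show False using same_class J j(1) j'(1) 1 False by blast
        qed
        moreover have "even i = even (Suc n)" using same_parity uSi uS by blast
        ultimately have "r (Suc (Suc n)) \<subseteq> r (Suc i)" by (intro r_mono) auto
        moreover have "(v, v') \<in> r (Suc (Suc n))" using in_class_rel[OF C] 1 FC by blast
        ultimately show ?thesis by blast
      next
        \<comment> \<open>the first coordinates lie in different \<open>r n\<close>-classes of \<open>C\<close>\<close>
        case 2
        have uS: "u \<in> S n" using 2 FC CS S_step by blast
        have "\<not> i \<le> n"
        proof
          assume "i \<le> n"
          then have "(u, u') \<in> r n" using r_mono_at[OF uu uS] by blast
          then show False using same_class 2 False unfolding F_def by blast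
        qed
        moreover have "even i = even n" using same_parity uSi uS by blast
        ultimately have "Suc (Suc n) \<le> i" by (metis le_SucE not_less_eq_eq even_Suc)
        then have "r (Suc (Suc (Suc n))) \<subseteq> r (Suc i)"
          using \<open>even i = even n\<close> by (intro r_mono) auto
        moreover have "(v, v') \<in> r (Suc (Suc (Suc n)))" using close 2 j(1) j'(1) by blast
        ultimately show ?thesis by blast
      qed
    qed
  qed
  moreover have "sym (\<Union>j\<in>J. T j)" using T'(1) by (auto simp: sym_def)
  ultimately show ?thesis using dom sub by (simp add: links_def)
qed

lemma links_Times:
  assumes D: "D \<in> S (Suc 0) // r (Suc 0)"
    and J: "J \<subseteq> S 0 // r 0" "J \<noteq> {}"
    and close: "\<And>v v'. v \<in> \<Union>J \<Longrightarrow> v' \<in> \<Union>J \<Longrightarrow> (v, v') \<in> r 2"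
  shows "links (D \<times> \<Union>J \<union> \<Union>J \<times> D) D (\<Union>J)"
proof -
  have DS: "D \<subseteq> S (Suc 0)" using class_subset[OF D] .
  have JS: "\<Union>J \<subseteq> S 0" using class_subset J(1) by blast
  have ne: "D \<noteq> {}" "\<Union>J \<noteq> {}"
    using D J equiv_r in_quotient_imp_non_empty by (metis, fastforce)
  have "controlled (D \<times> \<Union>J \<union> \<Union>J \<times> D)"
    unfolding controlled_def
  proof (intro allI impI)
    fix i u v u' v'
    assume uv: "(u, v) \<in> D \<times> \<Union>J \<union> \<Union>J \<times> D" "(u', v') \<in> D \<times> \<Union>J \<union> \<Union>J \<times> D"
      and uu: "(u, u') \<in> r i"
    have uSi: "u \<in> S i" "u' \<in> S i" using uu r_subset by blast+
    show "(v, v') \<in> r (Suc i)"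
    proof (cases "even i")
      case True
      then have "u \<in> \<Union>J" "u' \<in> \<Union>J"
        using same_parity[OF uSi(1), of "Suc 0"] same_parity[OF uSi(2), of "Suc 0"] uv DS by auto
      then have "v \<in> D" "v' \<in> D" using uv DS JS S_disjoint by blast+
      then have "(v, v') \<in> r (Suc 0)" using in_class_rel[OF D] by blast
      moreover have "r (Suc 0) \<subseteq> r (Suc i)" using True by (intro r_mono) auto
      ultimately show ?thesis by blast
    next
      case False
      then have "u \<in> D" "u' \<in> D"
        using same_parity[OF uSi(1), of 0] same_parity[OF uSi(2), of 0] uv JS by auto
      then have "v \<in> \<Union>J" "v' \<in> \<Union>J" using uv DS JS S_disjoint by blast+
      then have "(v, v') \<in> r 2" using close by blast
      moreover have "r 2 \<subseteq> r (Suc i)" using False by (intro r_mono) (auto elim: oddE)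
      ultimately show ?thesis by blast
    qed
  qed
  then show ?thesis using ne by (auto simp: links_def sym_def)
qed

lemma links_exists:
  assumes "D \<in> S (Suc n) // r (Suc n)" "J \<subseteq> S n // r n" "G n J"
    and "\<And>v v'. v \<in> \<Union>J \<Longrightarrow> v' \<in> \<Union>J \<Longrightarrow> (v, v') \<in> r (Suc (Suc n))"
  shows "\<exists>R. links R D (\<Union>J)"
  using assms
proof (induction n arbitrary: D J)
  case 0
  have "links (D \<times> \<Union>J \<union> \<Union>J \<times> D) D (\<Union>J)"
    by (intro links_Times) (use 0 G_nonempty in \<open>auto simp: numeral_2_eq_2\<close>)
  then show ?case ..
next
  case (Suc n)
  obtain u where "u \<in> D" using Suc.prems(1) equiv_r in_quotient_imp_non_empty by (metis ex_in_conv)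
  then obtain a0 where a0: "a0 \<in> S n // r n" "a0 \<subseteq> D" using Union_classes[OF Suc.prems(1)] by blast
  obtain j0 where "j0 \<in> J" using G_nonempty Suc.prems(3) by blast
  then obtain h where h: "h \<in> {a \<in> S n // r n. a \<subseteq> D} \<rightarrow> J"
      "\<And>j. j \<in> J \<Longrightarrow> G n {a \<in> S n // r n. a \<subseteq> D \<and> h a = j}"
    using split[OF Suc.prems(1) a0] Suc.prems(2,3) by meson
  have "\<exists>R. links R j (\<Union>{a \<in> S n // r n. a \<subseteq> D \<and> h a = j})" if "j \<in> J" for j
  proof (rule Suc.IH)
    show "(v, v') \<in> r (Suc (Suc n))"
      if "v \<in> \<Union>{a \<in> S n // r n. a \<subseteq> D \<and> h a = j}" "v' \<in> \<Union>{a \<in> S n // r n. a \<subseteq> D \<and> h a = j}" for v v'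
      using in_class_rel[OF Suc.prems(1)] that by blast
  qed (use that Suc.prems(2) h(2) in auto)
  then obtain T where "\<And>j. j \<in> J \<Longrightarrow> links (T j) j (\<Union>{a \<in> S n // r n. a \<subseteq> D \<and> h a = j})" by metis
  then have "links (\<Union>j\<in>J. T j) D (\<Union>J)"
    by (intro links_glue[OF Suc.prems(1,2) _ h(1)]) (use Suc.prems(4) in auto)
  then show ?case ..
qed

text \<open>
  The choice depends on \<open>n\<close> only through \<open>S n\<close>: there is one base point on either side, for all levels.
\<close>

definition base :: "nat \<Rightarrow> 'c" where "base n = (SOME x. x \<in> S n)"

definition base_class :: "nat \<Rightarrow> 'c set" where "base_class n = r n `` {base n}"

lemma base_in: "base n \<in> S n"
  using S_nonempty[of n] by (auto simp: base_def intro: someI)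

lemma base_class_in: "base_class n \<in> S n // r n"
  unfolding base_class_def using base_in by (rule quotientI)

lemma base_class_step: "base_class n \<subseteq> base_class (Suc (Suc n))"
  using r_step[of n] S_step[of n] by (auto simp: base_class_def base_def)

lemma ex_base_class:
  assumes "x \<in> S n" shows "\<exists>m. x \<in> base_class (n + 2 * m)"
proof -
  obtain m where "(base n, x) \<in> r (n + 2 * m)" using exhaust[OF base_in assms] by blast
  moreover have "S (n + 2 * m) = S n" by (induction m) (auto simp: S_step)
  ultimately have "x \<in> base_class (n + 2 * m)" by (simp add: base_class_def base_def)
  then show ?thesis ..
qed

text \<open>
  A family around the base point that qualifies as the set \<open>A0\<close> of the assumption \<open>split\<close>.
\<close>

definition splittable :: "nat \<Rightarrow> 'c set set \<Rightarrow> bool" where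
  "splittable n A0 \<longleftrightarrow> base_class n \<in> A0 \<and>
     A0 \<subseteq> {a \<in> S n // r n. a \<subseteq> base_class (Suc (Suc n))} \<and> G n A0 \<and>
     (\<forall>J j0. J \<subseteq> S (Suc n) // r (Suc n) \<longrightarrow> G (Suc n) J \<longrightarrow> j0 \<in> J \<longrightarrow>
        (\<exists>h \<in> {a \<in> S n // r n. a \<subseteq> base_class (Suc (Suc n))} \<rightarrow> J.
           (\<forall>j\<in>J. G n {a \<in> S n // r n. a \<subseteq> base_class (Suc (Suc n)) \<and> h a = j}) \<and>
           {a \<in> S n // r n. a \<subseteq> base_class (Suc (Suc n)) \<and> h a = j0} = A0))"

lemma ex_splittable: "\<exists>A0. splittable n A0"
  using split[OF base_class_in base_class_in base_class_step, of n] unfolding splittable_def .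

lemma splittableD:
  assumes "splittable n J"
  shows "base_class n \<in> J" "J \<subseteq> {a \<in> S n // r n. a \<subseteq> base_class (Suc (Suc n))}" "G n J"
  using assms[unfolded splittable_def, THEN conjunct1]
    assms[unfolded splittable_def, THEN conjunct2, THEN conjunct1]
    assms[unfolded splittable_def, THEN conjunct2, THEN conjunct2, THEN conjunct1] .

lemma splittable_fibres:
  assumes "splittable n A0" "J \<subseteq> S (Suc n) // r (Suc n)" "G (Suc n) J" "j0 \<in> J"
  shows "\<exists>h. h \<in> {a \<in> S n // r n. a \<subseteq> base_class (Suc (Suc n))} \<rightarrow> J \<and>
    (\<forall>j\<in>J. G n {a \<in> S n // r n. a \<subseteq> base_class (Suc (Suc n)) \<and> h a = j}) \<and>
    {a \<in> S n // r n. a \<subseteq> base_class (Suc (Suc n)) \<and> h a = j0} = A0"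
  using assms(1)[unfolded splittable_def, THEN conjunct2, THEN conjunct2, THEN conjunct2,
      THEN spec, THEN spec, THEN mp, THEN mp, THEN mp, OF assms(2-4)]
  unfolding Bex_def .

lemma splittable_close:
  "splittable n J \<Longrightarrow> v \<in> \<Union>J \<Longrightarrow> v' \<in> \<Union>J \<Longrightarrow> (v, v') \<in> r (Suc (Suc n))"
  using in_class_rel[OF base_class_in[of "Suc (Suc n)"]] splittableD(2)[of n J] by blast

text \<open>
  The links around the base points can be chosen as an increasing sequence: when the classes of the
  next level are distributed, the base class is assigned exactly the family \<open>J\<close> that it is
  already linked with.
\<close>

lemma links_extend:
  assumes J: "splittable n J" and R: "links R (base_class (Suc n)) (\<Union>J)"
  shows "\<exists>R' J'. splittable (Suc n) J' \<and> links R' (base_class (Suc (Suc n))) (\<Union>J') \<and> R \<subseteq> R'"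
proof -
  let ?C = "base_class (Suc (Suc n))"
  obtain J' where J': "splittable (Suc n) J'" using ex_splittable by blast
  have sub: "J' \<subseteq> S (Suc n) // r (Suc n)" and j0: "base_class (Suc n) \<in> J'" and GJ: "G (Suc n) J'"
    using splittableD[OF J'] by auto
  obtain h where "h \<in> {a \<in> S n // r n. a \<subseteq> ?C} \<rightarrow> J' \<and>
      (\<forall>j\<in>J'. G n {a \<in> S n // r n. a \<subseteq> ?C \<and> h a = j}) \<and>
      {a \<in> S n // r n. a \<subseteq> ?C \<and> h a = base_class (Suc n)} = J"
    using splittable_fibres[OF J sub GJ j0] ..
  then have h: "h \<in> {a \<in> S n // r n. a \<subseteq> ?C} \<rightarrow> J'"
      "\<And>j. j \<in> J' \<Longrightarrow> G n {a \<in> S n // r n. a \<subseteq> ?C \<and> h a = j}"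
      "{a \<in> S n // r n. a \<subseteq> ?C \<and> h a = base_class (Suc n)} = J"
    by simp_all
  have "\<exists>R. links R j (\<Union>{a \<in> S n // r n. a \<subseteq> ?C \<and> h a = j})" if "j \<in> J'" for j
  proof (rule links_exists)
    show "(v, v') \<in> r (Suc (Suc n))"
      if "v \<in> \<Union>{a \<in> S n // r n. a \<subseteq> ?C \<and> h a = j}" "v' \<in> \<Union>{a \<in> S n // r n. a \<subseteq> ?C \<and> h a = j}" for v v'
      using in_class_rel[OF base_class_in] that by blast
  qed (use that sub h(2) in auto)
  then obtain T where T: "\<And>j. j \<in> J' \<Longrightarrow> links (T j) j (\<Union>{a \<in> S n // r n. a \<subseteq> ?C \<and> h a = j})" by metis
  \<comment> \<open>keep the given relation over the base class and use fresh ones elsewhere\<close>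
  define T' where "T' = T(base_class (Suc n) := R)"
  have "links (\<Union>j\<in>J'. T' j) ?C (\<Union>J')"
  proof (rule links_glue[OF base_class_in sub _ h(1)])
    show "links (T' j) j (\<Union>{a \<in> S n // r n. a \<subseteq> ?C \<and> h a = j})" if "j \<in> J'" for j
    proof (cases "j = base_class (Suc n)")
      case True
      then show ?thesis using R h(3) by (simp add: T'_def)
    next
      case False
      then show ?thesis using T that by (simp add: T'_def)
    qed
  qed (rule splittable_close[OF J'])
  moreover have "R \<subseteq> (\<Union>j\<in>J'. T' j)" using j0 by (auto simp: T'_def)
  ultimately show ?thesis using J' by blast
qed

theorem ex_linking_relation:
  "\<exists>R. sym R \<and> R \<subseteq> S 0 \<times> S (Suc 0) \<union> S (Suc 0) \<times> S 0 \<and> Domain R = S 0 \<union> S (Suc 0) \<and> controlled R"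
proof -
  let ?P = "\<lambda>n x. splittable n (snd x) \<and> links (fst x) (base_class (Suc n)) (\<Union>(snd x))"
  have "\<exists>f. \<forall>n. ?P n (f n) \<and> fst (f n) \<subseteq> fst (f (Suc n))"
  proof (rule dependent_nat_choice)
    obtain J where J: "splittable 0 J" using ex_splittable by blast
    have "\<exists>R. links R (base_class (Suc 0)) (\<Union>J)"
      by (rule links_exists[OF base_class_in]) (use splittableD[OF J] splittable_close[OF J] in auto)
    then show "\<exists>x. ?P 0 x" using J by auto
  next
    fix x n assume "?P n x"
    then have "splittable n (snd x)" "links (fst x) (base_class (Suc n)) (\<Union>(snd x))" by auto
    from links_extend[OF this] obtain R' J'
      where "splittable (Suc n) J'" "links R' (base_class (Suc (Suc n))) (\<Union>J')" "fst x \<subseteq> R'" by blast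
    then have "?P (Suc n) (R', J') \<and> fst x \<subseteq> fst (R', J')" by simp
    then show "\<exists>y. ?P (Suc n) y \<and> fst x \<subseteq> fst y" ..
  qed
  then obtain f where f: "\<And>n. ?P n (f n)" "\<And>n. fst (f n) \<subseteq> fst (f (Suc n))" by blast
  define Q where "Q n = fst (f n)" for n
  define J where "J n = snd (f n)" for n
  have JQ: "splittable n (J n)" "links (Q n) (base_class (Suc n)) (\<Union>(J n))" for n
    using f(1)[of n] by (auto simp: Q_def J_def)
  have mono: "Q m \<subseteq> Q n" if "m \<le> n" for m n
    unfolding Q_def using lift_Suc_mono_le[of "\<lambda>n. fst (f n)", OF f(2) that] .
  have S01: "S n = S 0 \<and> S (Suc n) = S (Suc 0) \<or> S n = S (Suc 0) \<and> S (Suc n) = S 0" for n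
    using S_parity[of n] S_parity[of "Suc n"] by (cases "even n") (auto simp: mod_Suc odd_iff_mod_2_eq_one)
  have D: "base_class n \<subseteq> S n" for n using class_subset[OF base_class_in] .
  have JS: "\<Union>(J n) \<subseteq> S n" for n
    using splittableD(2)[OF JQ(1)[of n]] class_subset by blast
  have "Q n \<subseteq> S 0 \<times> S (Suc 0) \<union> S (Suc 0) \<times> S 0" for n
  proof -
    have "Q n \<subseteq> base_class (Suc n) \<times> \<Union>(J n) \<union> \<Union>(J n) \<times> base_class (Suc n)"
      using JQ(2)[of n] by (simp add: links_def)
    also have "\<dots> \<subseteq> S (Suc n) \<times> S n \<union> S n \<times> S (Suc n)" using D[of "Suc n"] JS[of n] by blast
    finally show ?thesis using S01[of n] by (elim disjE) auto
  qed
  then have sub: "(\<Union>n. Q n) \<subseteq> S 0 \<times> S (Suc 0) \<union> S (Suc 0) \<times> S 0" by blast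
  have symQ: "sym (\<Union>n. Q n)"
    using JQ(2) unfolding links_def sym_def by blast
  have "base_class n \<subseteq> Domain (\<Union>n. Q n)" for n
  proof -
    have "base_class n \<subseteq> Domain (Q n)"
      using splittableD(1)[OF JQ(1)[of n]] JQ(2)[of n] unfolding links_def by blast
    then show ?thesis by blast
  qed
  then have Sdom: "S n \<subseteq> Domain (\<Union>n. Q n)" for n using ex_base_class by (meson subset_iff)
  have "Domain (\<Union>n. Q n) \<subseteq> S 0 \<union> S (Suc 0)" using Domain_mono[OF sub] by auto
  then have "Domain (\<Union>n. Q n) = S 0 \<union> S (Suc 0)" using Sdom[of 0] Sdom[of "Suc 0"]
    by (intro subset_antisym Un_least)
  moreover have "controlled (\<Union>n. Q n)"
    unfolding controlled_def
  proof (intro allI impI)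
    fix i u v u' v'
    assume "(u, v) \<in> (\<Union>n. Q n)" "(u', v') \<in> (\<Union>n. Q n)" and uu: "(u, u') \<in> r i"
    then obtain m n where "(u, v) \<in> Q m" "(u', v') \<in> Q n" by blast
    then have "(u, v) \<in> Q (max m n)" "(u', v') \<in> Q (max m n)"
      using mono[of m "max m n"] mono[of n "max m n"] by auto
    then show "(v, v') \<in> r (Suc i)"
      using JQ(2)[of "max m n"] uu controlledD unfolding links_def by meson
  qed
  ultimately show ?thesis using sub symQ by (intro exI[of _ "\<Union>n. Q n"] conjI)
qed

end

section \<open>Distributing sets with prescribed fibre sizes\<close>

lemma balanced_map:
  assumes "finite J" "finite A" "card J * \<beta> \<le> card A" "card A \<le> card J * Suc \<beta>"
  shows "\<exists>h\<in>A \<rightarrow> J. \<forall>j\<in>J. card {a \<in> A. h a = j} \<in> {\<beta>, Suc \<beta>}"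
  using assms
proof (induction J arbitrary: A rule: finite_induct)
  case empty
  then show ?case by simp
next
  case (insert j J)
  \<comment> \<open>give \<open>j\<close> the smaller share, unless the rest would then be too large for the other elements\<close>
  define b where "b = (if card A \<le> card J * Suc \<beta> + \<beta> then \<beta> else Suc \<beta>)"
  have b: "b \<in> {\<beta>, Suc \<beta>}" "b \<le> card A" "card J * \<beta> \<le> card A - b" "card A - b \<le> card J * Suc \<beta>"
    using insert.prems(2,3) insert.hyps by (auto simp: b_def)
  obtain T where T: "T \<subseteq> A" "card T = b" using obtain_subset_with_card_n[OF b(2)] by metis
  have fT: "finite T" using T(1) insert.prems(1) finite_subset by blast
  have "card (A - T) = card A - b" using T fT by (simp add: card_Diff_subset)
  then obtain h where h: "h \<in> A - T \<rightarrow> J" "\<And>i. i \<in> J \<Longrightarrow> card {a \<in> A - T. h a = i} \<in> {\<beta>, Suc \<beta>}"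
    using insert.IH[of "A - T"] insert.prems(1) b by auto
  define h' where "h' a = (if a \<in> T then j else h a)" for a
  have hA: "h' \<in> A \<rightarrow> insert j J" using h(1) by (auto simp: h'_def Pi_iff)
  have hj: "{a \<in> A. h' a = j} = T" using T(1) h(1) insert.hyps(2) by (auto simp: h'_def Pi_iff)
  have hi: "{a \<in> A. h' a = i} = {a \<in> A - T. h a = i}" if "i \<in> J" for i
    using that insert.hyps(2) by (auto simp: h'_def Pi_iff)
  have "card {a \<in> A. h' a = i} \<in> {\<beta>, Suc \<beta>}" if i: "i \<in> insert j J" for i
  proof (cases "i = j")
    case True
    then show ?thesis using hj T(2) b(1) by simp
  next
    case False
    then have "i \<in> J" using i by simp
    then show ?thesis using hi[of i] h(2)[of i] by simp
  qed
  then show ?case using hA by blast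
qed

text \<open>
  When the target has exactly \<open>c\<close> elements, fibres of a constant size exist only under a divisibility
  condition. Allowing two consecutive sizes, for the fibres as well as for the target, removes it as soon as
  \<open>A\<close> is large: a set of \<open>k\<close> elements can be cut into \<open>c\<close> pieces of size \<open>\<beta>\<close> or \<open>\<beta> + 1\<close> iff
  \<open>c * \<beta> \<le> k \<le> c * (\<beta> + 1)\<close>, and for \<open>k \<ge> 2 * \<beta> * (\<beta> + 1)\<close> the quotient \<open>q\<close> of \<open>k\<close> by \<open>\<beta> + 1\<close> is such
  that both \<open>c = q + 1\<close> and \<open>c = q + 2\<close> satisfy these inequalities, even after a piece of size
  \<open>\<beta>\<close> has been set aside for \<open>j0\<close>.
\<close>

lemma finite_split:
  assumes A: "finite A" "a0 \<in> A" and \<beta>: "\<beta> \<ge> 1" and k: "2 * \<beta> * Suc \<beta> \<le> card A"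
  shows "\<exists>A0. a0 \<in> A0 \<and> A0 \<subseteq> A \<and> card A0 = \<beta> \<and>
    (\<forall>J j0. finite J \<longrightarrow> card J \<in> {Suc (card A div Suc \<beta>), Suc (Suc (card A div Suc \<beta>))} \<longrightarrow> j0 \<in> J \<longrightarrow>
      (\<exists>h\<in>A \<rightarrow> J. (\<forall>j\<in>J. card {a \<in> A. h a = j} \<in> {\<beta>, Suc \<beta>}) \<and> {a \<in> A. h a = j0} = A0))"
proof -
  define q where "q = card A div Suc \<beta>"
  have q1: "q * Suc \<beta> \<le> card A" "card A < Suc q * Suc \<beta>"
    unfolding q_def using div_times_less_eq_dividend[of "card A" "Suc \<beta>"]
      dividend_less_div_times[of "Suc \<beta>" "card A"] by (simp_all only: mult_Suc)
  have "2 * \<beta> = 2 * \<beta> * Suc \<beta> div Suc \<beta>" by (metis nonzero_mult_div_cancel_right nat.simps(3))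
  also have "\<dots> \<le> q" unfolding q_def by (rule div_le_mono[OF k])
  finally have q2: "2 * \<beta> \<le> q" .
  have "\<beta> - 1 \<le> card (A - {a0})" using k A by (simp add: card_Diff_singleton diff_le_mono le_trans[of \<beta>])
  then obtain T where T: "T \<subseteq> A - {a0}" "card T = \<beta> - 1" "finite T" by (rule obtain_subset_with_card_n)
  define A0 where "A0 = insert a0 T"
  have A0: "a0 \<in> A0" "A0 \<subseteq> A" "card A0 = \<beta>" "finite A0"
    using T A(2) \<beta> by (auto simp: A0_def card_insert_if)
  have "\<exists>h\<in>A \<rightarrow> J. (\<forall>j\<in>J. card {a \<in> A. h a = j} \<in> {\<beta>, Suc \<beta>}) \<and> {a \<in> A. h a = j0} = A0"
    if J: "finite J" "card J \<in> {Suc q, Suc (Suc q)}" "j0 \<in> J" for J j0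
  proof -
    have cJ: "card (J - {j0}) = card J - 1" using J(3) by (simp add: card_Diff_singleton)
    have cA: "card (A - A0) = card A - \<beta>" using A0 by (simp add: card_Diff_subset)
    have "(card J - 1) * \<beta> \<le> Suc q * \<beta>" using J(2) by (intro mult_le_mono1) auto
    also have "\<dots> \<le> card A - \<beta>" using q1(1) q2 by simp
    finally have le1: "card (J - {j0}) * \<beta> \<le> card (A - A0)" by (simp add: cJ cA)
    have "card A - \<beta> \<le> q * Suc \<beta>" using q1(2) by simp
    also have "\<dots> \<le> (card J - 1) * Suc \<beta>" using J(2) by (intro mult_le_mono1) auto
    finally have le2: "card (A - A0) \<le> card (J - {j0}) * Suc \<beta>" by (simp add: cJ cA)
    obtain h where h: "h \<in> A - A0 \<rightarrow> J - {j0}"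
        "\<And>j. j \<in> J - {j0} \<Longrightarrow> card {a \<in> A - A0. h a = j} \<in> {\<beta>, Suc \<beta>}"
      using balanced_map[OF _ _ le1 le2] A(1) J(1) by auto
    define h' where "h' a = (if a \<in> A0 then j0 else h a)" for a
    have "h' \<in> A \<rightarrow> J" using h(1) J(3) by (auto simp: h'_def Pi_iff)
    moreover have h0: "{a \<in> A. h' a = j0} = A0" using A0(2) h(1) by (auto simp: h'_def Pi_iff)
    moreover have "card {a \<in> A. h' a = j} \<in> {\<beta>, Suc \<beta>}" if j: "j \<in> J" for j
    proof (cases "j = j0")
      case True
      then show ?thesis using h0 A0(3) by simp
    next
      case False
      then have "{a \<in> A. h' a = j} = {a \<in> A - A0. h a = j}" by (auto simp: h'_def Pi_iff)
      then show ?thesis using h(2)[of j] j False by simp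
    qed
    ultimately show ?thesis by blast
  qed
  then show ?thesis using A0 unfolding q_def by blast
qed

text \<open>
  Since \<open>|A \<times> B| = |A|\<close>, the set \<open>A\<close> is partitioned by a map \<open>p : A \<rightarrow> A\<close> with all fibres of size \<open>|B|\<close>; the
  fibre of \<open>p a0\<close> is the prescribed one. A bijection from \<open>A\<close> to \<open>J\<close> that sends \<open>p a0\<close> to \<open>j0\<close> turns \<open>p\<close>
  into the desired map.
\<close>

lemma infinite_split:
  assumes A: "infinite A" "a0 \<in> A" and B: "B \<noteq> {}" "|B| \<le>o |A|"
  shows "\<exists>A0. a0 \<in> A0 \<and> A0 \<subseteq> A \<and> |A0| =o |B| \<and>
    (\<forall>J j0. |J| =o |A| \<longrightarrow> j0 \<in> J \<longrightarrow>
      (\<exists>h\<in>A \<rightarrow> J. (\<forall>j\<in>J. |{a \<in> A. h a = j}| =o |B| ) \<and> {a \<in> A. h a = j0} = A0))"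
proof -
  have "|A| =o |A \<times> B|" using A(1) B by (rule card_of_Times_infinite_simps(2))
  then obtain \<phi> where \<phi>: "bij_betw \<phi> A (A \<times> B)" using card_of_ordIso by blast
  define p where "p a = fst (\<phi> a)" for a
  have pA: "p a \<in> A" if "a \<in> A" for a using bij_betwE[OF \<phi>] that by (auto simp: p_def mem_Times_iff)
  have fibre: "|{a \<in> A. p a = c}| =o |B|" if c: "c \<in> A" for c
  proof -
    have "bij_betw \<phi> {a \<in> A. p a = c} ({c} \<times> B)"
    proof (rule bij_betw_subset[OF \<phi>])
      show "\<phi> ` {a \<in> A. p a = c} = {c} \<times> B"
      proof
        show "\<phi> ` {a \<in> A. p a = c} \<subseteq> {c} \<times> B"
        proof
          fix z assume "z \<in> \<phi> ` {a \<in> A. p a = c}"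
          then show "z \<in> {c} \<times> B" using bij_betwE[OF \<phi>] by (auto simp: p_def mem_Times_iff)
        qed
        show "{c} \<times> B \<subseteq> \<phi> ` {a \<in> A. p a = c}"
        proof
          fix z assume z: "z \<in> {c} \<times> B"
          then have "z \<in> \<phi> ` A" using \<phi> c by (auto simp: bij_betw_def)
          then obtain a where a: "a \<in> A" "z = \<phi> a" by blast
          then have "p a = c" using z by (simp add: p_def mem_Times_iff)
          then show "z \<in> \<phi> ` {a \<in> A. p a = c}" using a by blast
        qed
      qed
    qed auto
    moreover have "bij_betw snd ({c} \<times> B) B" by (auto simp: bij_betw_def inj_on_def)
    ultimately have "bij_betw (snd \<circ> \<phi>) {a \<in> A. p a = c} B" by (rule bij_betw_trans)
    then show ?thesis by (rule card_of_ordIsoI)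
  qed
  define A0 where "A0 = {a \<in> A. p a = p a0}"
  have "\<exists>h\<in>A \<rightarrow> J. (\<forall>j\<in>J. |{a \<in> A. h a = j}| =o |B| ) \<and> {a \<in> A. h a = j0} = A0"
    if J: "|J| =o |A|" "j0 \<in> J" for J j0
  proof -
    obtain \<psi>0 where \<psi>0: "bij_betw \<psi>0 A J" using ordIso_symmetric[OF J(1)] card_of_ordIso by blast
    obtain d where d: "d \<in> A" "\<psi>0 d = j0" using \<psi>0 J(2) by (auto simp: bij_betw_def)
    define \<psi> where "\<psi> = \<psi>0 \<circ> Transposition.transpose (p a0) d"
    have "bij_betw \<psi> A J"
      unfolding \<psi>_def by (rule bij_betw_trans[OF _ \<psi>0]) (use d pA A(2) in simp)
    moreover have "\<psi> (p a0) = j0" using d by (simp add: \<psi>_def)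
    ultimately have \<psi>: "bij_betw \<psi> A J" "\<psi> (p a0) = j0" .
    have eq: "{a \<in> A. \<psi> (p a) = \<psi> c} = {a \<in> A. p a = c}" if "c \<in> A" for c
      using \<psi>(1) pA that by (auto simp: bij_betw_def inj_on_def)
    have "|{a \<in> A. \<psi> (p a) = j}| =o |B|" if j: "j \<in> J" for j
    proof -
      obtain c where "c \<in> A" "\<psi> c = j" using \<psi>(1) j by (auto simp: bij_betw_def)
      then show ?thesis using eq[of c] fibre[of c] by simp
    qed
    moreover have "{a \<in> A. \<psi> (p a) = j0} = A0"
      using eq[of "p a0"] pA A(2) \<psi>(2) by (simp add: A0_def)
    moreover have "(\<lambda>a. \<psi> (p a)) \<in> A \<rightarrow> J" using pA bij_betwE[OF \<psi>(1)] by auto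
    ultimately show ?thesis by (intro bexI[of _ "\<lambda>a. \<psi> (p a)"] conjI ballI)
  qed
  moreover have "|A0| =o |B|" unfolding A0_def by (rule fibre) (use pA A(2) in simp)
  moreover have "a0 \<in> A0" "A0 \<subseteq> A" using A(2) by (auto simp: A0_def)
  ultimately show ?thesis by blast
qed

section \<open>The number of balls in a ball\<close>

lemma balls_antimono:
  assumes "ultrametric X" "0 < s" "s \<le> s'" "B \<subseteq> mspace X"
  shows "|balls X s' B| \<le>o |balls X s B|"
proof (rule surj_imp_ordLeq)
  show "balls X s' B \<subseteq> (\<lambda>b. \<Union>z\<in>b. mball_of X z s') ` balls X s B"
  proof
    fix b assume "b \<in> balls X s' B"
    then obtain x where x: "x \<in> B" "b = mball_of X x s'" by (auto simp: balls_def)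
    then have xX: "x \<in> mspace X" using assms(4) by blast
    have "mball_of X z s' = mball_of X x s'" if "z \<in> mball_of X x s" for z
      using that assms(3) by (intro mball_eq[symmetric] assms(1)) auto
    moreover have "x \<in> mball_of X x s" using xX assms(2) by simp
    ultimately have "(\<Union>z\<in>mball_of X x s. mball_of X z s') = b" unfolding x(2) by blast
    then show "b \<in> (\<lambda>b. \<Union>z\<in>b. mball_of X z s') ` balls X s B"
      using x(1) by (auto simp: balls_def)
  qed
qed

lemma finite_subset_mball:
  assumes "finite P" "P \<subseteq> mspace X" "x \<in> mspace X"
  shows "\<exists>t. P \<subseteq> mball_of X x t"
proof -
  have "finite (mdist X x ` P)" using assms(1) by simp
  then obtain t where "\<And>p. p \<in> P \<Longrightarrow> mdist X x p < t"
    by (metis bdd_above_finite bdd_above.E gt_ex image_eqI order_le_less_trans)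
  then show ?thesis using assms(2,3) by (intro exI[of _ t]) auto
qed

text \<open>
  Finitely many balls of radius \<open>s\<close> form a bounded set, so an unbounded space contains
  infinitely many of them, and any finite number of these fits into one large ball.
\<close>

lemma unbounded_card_balls:
  assumes "0 < s" "x \<in> mspace X"
    and unbounded: "\<And>t. \<not> mspace X \<subseteq> mball_of X x t"
    and fin: "\<And>t. finite (balls X s (mball_of X x t))"
  shows "\<exists>t. m \<le> card (balls X s (mball_of X x t))"
proof (cases "finite (balls X s (mspace X))")
  case True
  then obtain P where P: "finite P" "P \<subseteq> mspace X" "balls X s (mspace X) = balls X s P"
    unfolding balls_def by (metis finite_subset_image order_refl)
  obtain t where t: "P \<subseteq> mball_of X x t" using finite_subset_mball[OF P(1,2) assms(2)] by blast
  have "mspace X \<subseteq> mball_of X x (t + s)"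
  proof
    fix y assume y: "y \<in> mspace X"
    then have "mball_of X y s \<in> balls X s P" using P(3) by (auto simp: balls_def)
    then obtain p where p: "p \<in> P" "mball_of X y s = mball_of X p s" by (auto simp: balls_def)
    have "y \<in> mball_of X y s" using y assms(1) by simp
    then have "y \<in> mball_of X p s" using p(2) by blast
    moreover have "p \<in> mball_of X x t" using t p(1) by blast
    ultimately show "y \<in> mball_of X x (t + s)"
      using mdist_triangle[of x X p y] by simp
  qed
  then show ?thesis using unbounded by blast
next
  case False
  then obtain F where F: "finite F" "card F = m" "F \<subseteq> balls X s (mspace X)"
    using infinite_arbitrarily_large by blast
  then obtain P where P: "finite P" "P \<subseteq> mspace X" "F = balls X s P"
    unfolding balls_def by (metis finite_subset_image)
  obtain t where "P \<subseteq> mball_of X x t" using finite_subset_mball[OF P(1,2) assms(2)] by blast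
  then have "F \<subseteq> balls X s (mball_of X x t)" unfolding P(3) balls_def by blast
  then have "m \<le> card (balls X s (mball_of X x t))" using card_mono[OF fin] F(2) by blast
  then show ?thesis ..
qed

section \<open>Alternating scales\<close>

text \<open>
  Two spaces on disjoint parts of one type, listed alternately as \<open>M 0\<close>, \<open>M 1\<close>, \<open>M 2\<close> and so on, so that one
  argument serves both. From scale \<open>\<epsilon>0\<close> on, the partitions of either space into balls are dominated by
  those of the other.
\<close>

locale alternating =
  fixes M :: "nat \<Rightarrow> 'c metric" and \<epsilon>0 :: real
  assumes M_step: "M (Suc (Suc n)) = M n"
    and M_disjoint: "mspace (M 0) \<inter> mspace (M (Suc 0)) = {}"
    and M_nonempty: "mspace (M n) \<noteq> {}"
    and ultra: "ultrametric (M n)"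
    and uniform: "\<lbrakk>x \<in> mspace (M n); y \<in> mspace (M n)\<rbrakk> \<Longrightarrow>
      |balls (M n) s (mball_of (M n) x t)| =o |balls (M n) s (mball_of (M n) y t)|"
    and unbounded: "\<not> mspace (M n) \<subseteq> mball_of (M n) x t"
    and \<epsilon>0_pos: "0 < \<epsilon>0"
    and dominated: "\<lbrakk>\<epsilon>0 \<le> s; \<epsilon>0 \<le> s'\<rbrakk> \<Longrightarrow> \<exists>t'. \<forall>x\<in>mspace (M n). \<forall>y\<in>mspace (M (Suc n)).
      |balls (M n) s (mball_of (M n) x t)| \<le>o |balls (M (Suc n)) s' (mball_of (M (Suc n)) y t')|"
begin

lemma M_add: "M (n + 2 * m) = M n"
  by (induction m) (auto simp: M_step)

text \<open>
  A coarse equivalence in the shape of a symmetric relation; both coarse maps are obtained from it by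
  choosing related points.
\<close>

definition linked :: bool where
  "linked \<longleftrightarrow> (\<exists>R. sym R \<and>
    R \<subseteq> mspace (M 0) \<times> mspace (M (Suc 0)) \<union> mspace (M (Suc 0)) \<times> mspace (M 0) \<and>
    Domain R = mspace (M 0) \<union> mspace (M (Suc 0)) \<and>
    (\<forall>n \<epsilon>. \<exists>\<delta>. \<forall>u v u' v'. (u, v) \<in> R \<longrightarrow> (u', v') \<in> R \<longrightarrow> u \<in> mspace (M n) \<longrightarrow> u' \<in> mspace (M n) \<longrightarrow>
       mdist (M n) u u' \<le> \<epsilon> \<longrightarrow> mdist (M (Suc n)) v v' \<le> \<delta>))"

definition near :: "(nat \<Rightarrow> real) \<Rightarrow> nat \<Rightarrow> 'c rel" where
  "near s n = {(x, y). x \<in> mspace (M n) \<and> y \<in> mspace (M n) \<and> mdist (M n) x y < s n}"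

lemma near_Image: "x \<in> mspace (M n) \<Longrightarrow> near s n `` {x} = mball_of (M n) x (s n)"
  by (auto simp: near_def)

lemma classes_balls:
  assumes "0 < s n" "s n \<le> s (Suc (Suc n))" "C = mball_of (M n) x (s (Suc (Suc n)))"
  shows "{a \<in> mspace (M n) // near s n. a \<subseteq> C} = balls (M n) (s n) C"
proof
  show "{a \<in> mspace (M n) // near s n. a \<subseteq> C} \<subseteq> balls (M n) (s n) C"
  proof
    fix a assume a: "a \<in> {a \<in> mspace (M n) // near s n. a \<subseteq> C}"
    then obtain y where y: "y \<in> mspace (M n)" "a = mball_of (M n) y (s n)"
      by (auto elim!: quotientE simp: near_Image)
    then have "y \<in> C" using assms(1) a by auto
    then show "a \<in> balls (M n) (s n) C" unfolding y(2) balls_def by blast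
  qed
  show "balls (M n) (s n) C \<subseteq> {a \<in> mspace (M n) // near s n. a \<subseteq> C}"
  proof
    fix a assume "a \<in> balls (M n) (s n) C"
    then obtain y where y: "y \<in> C" "a = mball_of (M n) y (s n)" by (auto simp: balls_def)
    have yM: "y \<in> mspace (M n)" using y(1) assms(3) by simp
    have "C = mball_of (M n) y (s (Suc (Suc n)))"
      using y(1) unfolding assms(3) by (intro mball_eq ultra) auto
    then have "a \<subseteq> C" using y(2) assms(2) by auto
    moreover have "a \<in> mspace (M n) // near s n"
      using quotientI[OF yM, of "near s n"] near_Image[OF yM] y(2) by simp
    ultimately show "a \<in> {a \<in> mspace (M n) // near s n. a \<subseteq> C}" by blast
  qed
qed

text \<open>
  A sequence of scales \<open>s\<close>, of which the even ones are used in \<open>M 0\<close> and the odd ones in \<open>M 1\<close>, yields two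
  towers of partitions into balls. What remains to be found are scales and admissible sizes \<open>G\<close>
  that satisfy the condition on distributions.
\<close>

lemma linking_relation:
  assumes pos: "\<And>n. 0 < s n" and step: "\<And>n. s n + 1 \<le> s (Suc (Suc n))"
    and G_nonempty: "\<And>n J. G n J \<Longrightarrow> J \<noteq> {}"
    and split: "\<And>n x a0. x \<in> mspace (M n) \<Longrightarrow>
      a0 \<in> balls (M n) (s n) (mball_of (M n) x (s (Suc (Suc n)))) \<Longrightarrow>
      \<exists>A0. a0 \<in> A0 \<and> A0 \<subseteq> balls (M n) (s n) (mball_of (M n) x (s (Suc (Suc n)))) \<and> G n A0 \<and>
        (\<forall>J j0. G (Suc n) J \<longrightarrow> j0 \<in> J \<longrightarrow>
          (\<exists>h \<in> balls (M n) (s n) (mball_of (M n) x (s (Suc (Suc n)))) \<rightarrow> J.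
             (\<forall>j\<in>J. G n {a \<in> balls (M n) (s n) (mball_of (M n) x (s (Suc (Suc n)))). h a = j}) \<and>
             {a \<in> balls (M n) (s n) (mball_of (M n) x (s (Suc (Suc n)))). h a = j0} = A0))"
  shows linked
proof -
  have s_add: "s n + real m \<le> s (n + 2 * m)" for n m
  proof (induction m)
    case (Suc m)
    then show ?case using step[of "n + 2 * m"] by simp
  qed simp
  have cofinal: "\<exists>m. K < s (n + 2 * m)" for K n
  proof -
    obtain m where "K - s n < real m" using reals_Archimedean2 by blast
    then show ?thesis using s_add[of n m] by (intro exI[of _ m]) linarith
  qed
  interpret Z: zigzag "\<lambda>n. mspace (M n)" "near s" G
  proof (unfold_locales, goal_cases)
    case (4 n)
    show ?case
    proof (rule equivI)
      show "near s n \<subseteq> mspace (M n) \<times> mspace (M n)" by (auto simp: near_def)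
      show "refl_on (mspace (M n)) (near s n)" using pos by (auto simp: refl_on_def near_def)
      show "sym (near s n)" by (auto simp: sym_def near_def mdist_commute)
      show "trans (near s n)"
        by (rule transI) (auto simp: near_def intro: ultrametric_less[OF ultra])
    qed
  next
    case (5 n)
    show ?case using step[of n] by (auto simp: near_def M_step)
  next
    case (6 x n y)
    then show ?case using cofinal[of "mdist (M n) x y" n] by (simp add: near_def M_add)
  next
    case (8 C n a0)
    have C: "C \<in> mspace (M n) // near s (Suc (Suc n))" using 8(1) M_step by simp
    then obtain x where x: "x \<in> mspace (M n)" "C = near s (Suc (Suc n)) `` {x}" by (rule quotientE)
    then have Cx: "C = mball_of (M n) x (s (Suc (Suc n)))" using near_Image[of x "Suc (Suc n)"] M_step by simp
    have le: "s n \<le> s (Suc (Suc n))" using step[of n] by linarith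
    have eq: "{a \<in> mspace (M n) // near s n. a \<subseteq> C} = balls (M n) (s n) (mball_of (M n) x (s (Suc (Suc n))))"
      using classes_balls[of s, OF pos le Cx] Cx by simp
    then have "a0 \<in> balls (M n) (s n) (mball_of (M n) x (s (Suc (Suc n))))" using 8 by blast
    note sp = split[OF x(1) this]
    have eq2: "{a \<in> mspace (M n) // near s n. a \<subseteq> C \<and> P a} =
        {a \<in> balls (M n) (s n) (mball_of (M n) x (s (Suc (Suc n)))). P a}" for P
      using eq by blast
    show ?case unfolding eq2 unfolding eq using sp by meson
  qed (use M_step M_disjoint M_nonempty G_nonempty in auto)
  obtain R where R: "sym R" "R \<subseteq> mspace (M 0) \<times> mspace (M (Suc 0)) \<union> mspace (M (Suc 0)) \<times> mspace (M 0)"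
    "Domain R = mspace (M 0) \<union> mspace (M (Suc 0))" "Z.controlled R"
    using Z.ex_linking_relation by blast
  have "\<exists>\<delta>. \<forall>u v u' v'. (u, v) \<in> R \<longrightarrow> (u', v') \<in> R \<longrightarrow> u \<in> mspace (M n) \<longrightarrow> u' \<in> mspace (M n) \<longrightarrow>
       mdist (M n) u u' \<le> \<epsilon> \<longrightarrow> mdist (M (Suc n)) v v' \<le> \<delta>" for n \<epsilon>
  proof -
    obtain m where m: "\<epsilon> < s (n + 2 * m)" using cofinal by blast
    have "mdist (M (Suc n)) v v' \<le> s (Suc (n + 2 * m))"
      if "(u, v) \<in> R" "(u', v') \<in> R" "u \<in> mspace (M n)" "u' \<in> mspace (M n)" "mdist (M n) u u' \<le> \<epsilon>"
      for u v u' v'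
    proof -
      have "(u, u') \<in> near s (n + 2 * m)" using that m by (simp add: near_def M_add)
      then have "(v, v') \<in> near s (Suc (n + 2 * m))" using Z.controlledD[OF R(4)] that by blast
      moreover have "M (Suc (n + 2 * m)) = M (Suc n)" using M_add[of "Suc n" m] by simp
      ultimately show ?thesis by (simp add: near_def)
    qed
    then show ?thesis by blast
  qed
  then show ?thesis unfolding linked_def using R(1-3) by blast
qed

text \<open>
  Dependent choice: a scale is chosen in view of the preceding two, together with a parameter \<open>b\<close> that
  records the admissible sizes.
\<close>

lemma alternating_scales:
  fixes Q :: "nat \<Rightarrow> real \<Rightarrow> real \<Rightarrow> 'b \<Rightarrow> real \<Rightarrow> 'b \<Rightarrow> bool"
  assumes init: "I b0"
    and step: "\<And>n s s' b. \<epsilon>0 \<le> s \<Longrightarrow> \<epsilon>0 \<le> s' \<Longrightarrow> I b \<Longrightarrow> \<exists>t b'. s + 1 \<le> t \<and> I b' \<and> Q n s s' b t b'"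
  shows "\<exists>s b. \<forall>n. \<epsilon>0 \<le> s n \<and> s n + 1 \<le> s (Suc (Suc n)) \<and> I (b n) \<and>
    Q n (s n) (s (Suc n)) (b n) (s (Suc (Suc n))) (b (Suc n))"
proof -
  \<comment> \<open>the state at stage \<open>n\<close> consists of the scales \<open>n\<close> and \<open>n + 1\<close> and the parameter \<open>n\<close>\<close>
  let ?P = "\<lambda>(n::nat) (s, s', b). \<epsilon>0 \<le> s \<and> \<epsilon>0 \<le> s' \<and> I b"
  let ?R = "\<lambda>n (s, s', b) (u, u', b'). u = s' \<and> s + 1 \<le> u' \<and> Q n s s' b u' b'"
  have "\<exists>f. \<forall>n. ?P n (f n) \<and> ?R n (f n) (f (Suc n))"
  proof (rule dependent_nat_choice)
    show "\<exists>x. ?P 0 x" using init by (intro exI[of _ "(\<epsilon>0, \<epsilon>0, b0)"]) simp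
  next
    fix x :: "real \<times> real \<times> 'b" and n assume x: "?P n x"
    obtain s s' b where xe: "x = (s, s', b)" by (cases x)
    then have inv: "\<epsilon>0 \<le> s" "\<epsilon>0 \<le> s'" "I b" using x by simp_all
    obtain t where "\<exists>b'. s + 1 \<le> t \<and> I b' \<and> Q n s s' b t b'" using step[OF inv] ..
    then obtain b' where t: "s + 1 \<le> t \<and> I b' \<and> Q n s s' b t b'" ..
    then have "?P (Suc n) (s', t, b') \<and> ?R n x (s', t, b')" using inv xe by simp
    then show "\<exists>y. ?P (Suc n) y \<and> ?R n x y" ..
  qed
  then obtain f where "\<forall>n. ?P n (f n) \<and> ?R n (f n) (f (Suc n))" ..
  then have f: "\<And>n. ?P n (f n)" "\<And>n. ?R n (f n) (f (Suc n))" by simp_all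
  define s where "s n = fst (f n)" for n
  define b where "b n = snd (snd (f n))" for n
  have f_eq: "f n = (s n, s (Suc n), b n)" for n
    using f(2)[of n] by (auto simp: s_def b_def split: prod.splits)
  have "\<epsilon>0 \<le> s n \<and> s n + 1 \<le> s (Suc (Suc n)) \<and> I (b n) \<and>
    Q n (s n) (s (Suc n)) (b n) (s (Suc (Suc n))) (b (Suc n))" for n
    using f(1)[of n] f(2)[of n] unfolding f_eq by simp
  then show ?thesis by (intro exI allI)
qed

lemma balls_mball_mono: "t \<le> t' \<Longrightarrow> |balls (M n) s (mball_of (M n) x t)| \<le>o |balls (M n) s (mball_of (M n) x t')|"
  by (intro balls_mono) auto

text \<open>
  Let \<open>K n\<close> be the number of balls of radius \<open>s n\<close> in a ball of radius \<open>s (n + 2)\<close>. By domination the scales can be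
  chosen such that \<open>K 0 \<le> K 1 \<le> K 2\<close> and so on, all infinite. A family of balls at level \<open>n\<close> is admissible if its size
  is \<open>K (n - 1)\<close>. With these sizes, \<open>K n\<close> balls are to be distributed over \<open>K n\<close> targets with
  fibres of size \<open>K (n - 1)\<close>, which is possible since \<open>K n * K (n - 1) = K n\<close>.
\<close>

lemma linked_infinite:
  assumes inf: "\<And>n s. \<epsilon>0 \<le> s \<Longrightarrow> \<exists>t. \<forall>x\<in>mspace (M n). infinite (balls (M n) s (mball_of (M n) x t))"
  shows linked
proof -
  \<comment> \<open>The scale \<open>s (n - 1)\<close>, at which \<open>K (n - 1)\<close> is counted, is not at hand when \<open>s (n + 2)\<close> is chosen;
    the count at the finer scale \<open>\<epsilon>0\<close> is an upper bound for it.\<close>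
  define Q where "Q n s s' (b::unit) t (b'::unit) \<longleftrightarrow> (\<forall>x\<in>mspace (M n). infinite (balls (M n) s (mball_of (M n) x t)) \<and>
    (\<forall>y\<in>mspace (M (Suc n)).
      |balls (M (Suc n)) \<epsilon>0 (mball_of (M (Suc n)) y s')| \<le>o |balls (M n) s (mball_of (M n) x t)| ))" for n s s' b t b'
  have "\<exists>t b'. s + 1 \<le> t \<and> True \<and> Q n s s' b t b'" if s: "\<epsilon>0 \<le> s" "\<epsilon>0 \<le> s'" for n s s' b
  proof -
    obtain t1 where t1: "\<And>x. x \<in> mspace (M n) \<Longrightarrow> infinite (balls (M n) s (mball_of (M n) x t1))"
      using inf[OF s(1)] by blast
    obtain t2 where t2: "\<And>x y. x \<in> mspace (M n) \<Longrightarrow> y \<in> mspace (M (Suc n)) \<Longrightarrow>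
        |balls (M (Suc n)) \<epsilon>0 (mball_of (M (Suc n)) y s')| \<le>o |balls (M n) s (mball_of (M n) x t2)|"
      using dominated[of \<epsilon>0 s "Suc n" s'] s unfolding M_step by auto
    define t where "t = max (s + 1) (max t1 t2)"
    have "Q n s s' b t b" unfolding Q_def
    proof (intro ballI conjI)
      fix x assume x: "x \<in> mspace (M n)"
      show "infinite (balls (M n) s (mball_of (M n) x t))"
        by (rule card_of_ordLeq_infinite[OF balls_mball_mono t1[OF x]]) (simp add: t_def)
      fix y assume y: "y \<in> mspace (M (Suc n))"
      show "|balls (M (Suc n)) \<epsilon>0 (mball_of (M (Suc n)) y s')| \<le>o |balls (M n) s (mball_of (M n) x t)|"
        by (rule ordLeq_transitive[OF t2[OF x y] balls_mball_mono]) (simp add: t_def)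
    qed
    then show ?thesis by (intro exI[of _ t] exI[of _ b]) (simp add: t_def)
  qed
  from alternating_scales[of "\<lambda>_. True" "()" Q, OF TrueI this]
  obtain s b where s: "\<And>n. \<epsilon>0 \<le> s n" "\<And>n. s n + 1 \<le> s (Suc (Suc n))"
      "\<And>n. Q n (s n) (s (Suc n)) (b n) (s (Suc (Suc n))) (b (Suc n))" by blast
  have pos: "0 < s n" for n using s(1)[of n] \<epsilon>0_pos by simp
  define x where "x n = (SOME x. x \<in> mspace (M n))" for n
  have x: "x n \<in> mspace (M n)" for n using M_nonempty[of n] by (auto simp: x_def intro: someI)
  define A where "A n y = balls (M n) (s n) (mball_of (M n) y (s (Suc (Suc n))))" for n y
  \<comment> \<open>\<open>B n\<close> represents \<open>K (n - 1)\<close>; at level \<open>0\<close> any nonzero cardinal below \<open>K 0\<close> would do, and \<open>1\<close> is taken\<close>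
  define B where "B n = (case n of 0 \<Rightarrow> {{}} | Suc m \<Rightarrow> A m (x m))" for n
  have B_Suc: "B (Suc n) = A n (x n)" for n by (simp add: B_def)
  have inf_A: "infinite (A n y)" if "y \<in> mspace (M n)" for n y
    using s(3)[of n] that unfolding Q_def A_def by blast
  have A_ne: "A n y \<noteq> {}" if "y \<in> mspace (M n)" for n y using inf_A[OF that] by auto
  have B_ne: "B n \<noteq> {}" for n using A_ne x by (cases n) (auto simp: B_def)
  have B_le: "|B n| \<le>o |A n y|" if y: "y \<in> mspace (M n)" for n y
  proof (cases n)
    case 0
    then show ?thesis using A_ne[OF y] by (simp add: B_def card_of_singl_ordLeq)
  next
    case (Suc m)
    have "|balls (M m) (s m) (mball_of (M m) (x m) (s (Suc (Suc m))))|
        \<le>o |balls (M m) \<epsilon>0 (mball_of (M m) (x m) (s (Suc (Suc m))))|"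
      by (intro balls_antimono ultra \<epsilon>0_pos s(1)) auto
    also have "|balls (M m) \<epsilon>0 (mball_of (M m) (x m) (s (Suc (Suc m))))| \<le>o |A n y|"
      using s(3)[of n] y x[of m] unfolding Q_def A_def Suc M_step by blast
    finally show ?thesis by (simp add: Suc B_Suc A_def)
  qed
  have B_iso: "|B (Suc n)| =o |A n y|" if "y \<in> mspace (M n)" for n y
    unfolding B_Suc A_def by (rule uniform[OF x that])
  show ?thesis
  proof (rule linking_relation[of s "\<lambda>n J. |J| =o |B n|", OF pos s(2)])
    show "J \<noteq> {}" if "|J| =o |B n|" for n and J :: "'c set set"
    proof
      assume "J = {}"
      then have "|B n| \<le>o |{}::'c set set|" using ordIso_imp_ordLeq[OF ordIso_symmetric[OF that]] by simp
      then show False using card_of_empty3 B_ne by blast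
    qed
    fix n y a0
    assume y: "y \<in> mspace (M n)" and a0: "a0 \<in> balls (M n) (s n) (mball_of (M n) y (s (Suc (Suc n))))"
    have iso: "|J| =o |A n y|" if "|J| =o |B (Suc n)|" for J :: "'c set set"
      by (rule ordIso_transitive[OF that B_iso[OF y]])
    have "a0 \<in> A n y" using a0 by (simp add: A_def)
    from infinite_split[OF inf_A[OF y] this B_ne B_le[OF y]]
    obtain A0 where ex: "a0 \<in> A0 \<and> A0 \<subseteq> A n y \<and> |A0| =o |B n| \<and>
      (\<forall>(J :: 'c set set) j0. |J| =o |A n y| \<longrightarrow> j0 \<in> J \<longrightarrow>
        (\<exists>h\<in>A n y \<rightarrow> J. (\<forall>j\<in>J. |{a \<in> A n y. h a = j}| =o |B n| ) \<and> {a \<in> A n y. h a = j0} = A0))" ..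
    note A0 = ex[THEN conjunct1] ex[THEN conjunct2, THEN conjunct1]
      ex[THEN conjunct2, THEN conjunct2, THEN conjunct1]
      ex[THEN conjunct2, THEN conjunct2, THEN conjunct2, THEN spec, THEN spec, THEN mp, THEN mp]
    show "\<exists>A0. a0 \<in> A0 \<and> A0 \<subseteq> balls (M n) (s n) (mball_of (M n) y (s (Suc (Suc n)))) \<and> |A0| =o |B n| \<and>
        (\<forall>(J :: 'c set set) j0. |J| =o |B (Suc n)| \<longrightarrow> j0 \<in> J \<longrightarrow>
          (\<exists>h \<in> balls (M n) (s n) (mball_of (M n) y (s (Suc (Suc n)))) \<rightarrow> J.
             (\<forall>j\<in>J. |{a \<in> balls (M n) (s n) (mball_of (M n) y (s (Suc (Suc n)))). h a = j}| =o |B n| ) \<and>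
             {a \<in> balls (M n) (s n) (mball_of (M n) y (s (Suc (Suc n)))). h a = j0} = A0))"
      unfolding A_def[symmetric]
    proof (intro exI[of _ A0] conjI allI impI)
      fix J :: "'c set set" and j0 assume "|J| =o |B (Suc n)|" "j0 \<in> J"
      then show "\<exists>h\<in>A n y \<rightarrow> J. (\<forall>j\<in>J. |{a \<in> A n y. h a = j}| =o |B n| ) \<and> {a \<in> A n y. h a = j0} = A0"
        by (rule A0(4)[OF iso])
    qed (rule A0(1-3))+
  qed
qed

text \<open>
  A family of balls at level \<open>n\<close> is admissible if its size is \<open>\<beta> n\<close> or \<open>\<beta> n + 1\<close>. Since the spaces are
  unbounded, the scale \<open>s (n + 2)\<close> can be chosen so large that \<open>finite_split\<close> applies, and
  that lemma dictates \<open>\<beta> (n + 1)\<close>.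
\<close>

lemma linked_finite:
  assumes fin: "\<And>n s t x. \<epsilon>0 \<le> s \<Longrightarrow> x \<in> mspace (M n) \<Longrightarrow> finite (balls (M n) s (mball_of (M n) x t))"
  shows linked
proof -
  define Q where "Q n s (s'::real) \<beta> t \<beta>' \<longleftrightarrow> (\<forall>x\<in>mspace (M n).
    2 * \<beta> * Suc \<beta> \<le> card (balls (M n) s (mball_of (M n) x t)) \<and>
    \<beta>' = Suc (card (balls (M n) s (mball_of (M n) x t)) div Suc \<beta>))" for n s s' \<beta> t \<beta>'
  have "\<exists>t \<beta>'. s + 1 \<le> t \<and> 1 \<le> \<beta>' \<and> Q n s s' \<beta> t \<beta>'" if s: "\<epsilon>0 \<le> s" "1 \<le> \<beta>" for n s s' \<beta>
  proof -
    obtain x where x: "x \<in> mspace (M n)" using M_nonempty[of n] by blast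
    have "\<exists>t. 2 * \<beta> * Suc \<beta> \<le> card (balls (M n) s (mball_of (M n) x t))"
      by (rule unbounded_card_balls) (use s \<epsilon>0_pos x unbounded fin in auto)
    then obtain t1 where t1: "2 * \<beta> * Suc \<beta> \<le> card (balls (M n) s (mball_of (M n) x t1))" by blast
    define t where "t = max (s + 1) t1"
    have "balls (M n) s (mball_of (M n) x t1) \<subseteq> balls (M n) s (mball_of (M n) x t)"
      unfolding balls_def by (rule image_mono) (auto simp: t_def)
    then have t: "2 * \<beta> * Suc \<beta> \<le> card (balls (M n) s (mball_of (M n) x t))"
      using card_mono[OF fin[OF s(1) x]] t1 le_trans by blast
    have "card (balls (M n) s (mball_of (M n) y t)) = card (balls (M n) s (mball_of (M n) x t))"
      if yM: "y \<in> mspace (M n)" for y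
    proof -
      obtain f where "bij_betw f (balls (M n) s (mball_of (M n) y t)) (balls (M n) s (mball_of (M n) x t))"
        using uniform[OF yM x] card_of_ordIso by blast
      then show ?thesis by (rule bij_betw_same_card)
    qed
    then have "Q n s s' \<beta> t (Suc (card (balls (M n) s (mball_of (M n) x t)) div Suc \<beta>))"
      using t unfolding Q_def by simp
    then show ?thesis
      by (intro exI[of _ t] exI[of _ "Suc (card (balls (M n) s (mball_of (M n) x t)) div Suc \<beta>)"])
        (simp add: t_def)
  qed
  from alternating_scales[of "\<lambda>\<beta>. 1 \<le> \<beta>" 1 Q, OF order_refl this]
  obtain s \<beta> where s: "\<And>n. \<epsilon>0 \<le> s n" "\<And>n. s n + 1 \<le> s (Suc (Suc n))" "\<And>n. 1 \<le> \<beta> n"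
      "\<And>n. Q n (s n) (s (Suc n)) (\<beta> n) (s (Suc (Suc n))) (\<beta> (Suc n))" by blast
  have pos: "0 < s n" for n using s(1)[of n] \<epsilon>0_pos by simp
  define A where "A n y = balls (M n) (s n) (mball_of (M n) y (s (Suc (Suc n))))" for n y
  show ?thesis
  proof (rule linking_relation[of s "\<lambda>n J. finite J \<and> card J \<in> {\<beta> n, Suc (\<beta> n)}", OF pos s(2)])
    show "J \<noteq> {}" if "finite J \<and> card J \<in> {\<beta> n, Suc (\<beta> n)}" for n and J :: "'c set set"
      using that s(3)[of n] by auto
    fix n y a0
    assume y: "y \<in> mspace (M n)" and a0: "a0 \<in> balls (M n) (s n) (mball_of (M n) y (s (Suc (Suc n))))"
    have A: "finite (A n y)" "a0 \<in> A n y" using fin[OF s(1) y] a0 by (simp_all add: A_def)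
    have k: "2 * \<beta> n * Suc (\<beta> n) \<le> card (A n y)" and \<beta>: "\<beta> (Suc n) = Suc (card (A n y) div Suc (\<beta> n))"
      using s(4)[of n] y unfolding Q_def A_def by blast+
    from finite_split[OF A s(3) k]
    obtain A0 where ex: "a0 \<in> A0 \<and> A0 \<subseteq> A n y \<and> card A0 = \<beta> n \<and>
      (\<forall>(J :: 'c set set) j0. finite J \<longrightarrow> card J \<in> {\<beta> (Suc n), Suc (\<beta> (Suc n))} \<longrightarrow> j0 \<in> J \<longrightarrow>
        (\<exists>h\<in>A n y \<rightarrow> J. (\<forall>j\<in>J. card {a \<in> A n y. h a = j} \<in> {\<beta> n, Suc (\<beta> n)}) \<and>
          {a \<in> A n y. h a = j0} = A0))"
      unfolding \<beta> ..
    note A0 = ex[THEN conjunct1] ex[THEN conjunct2, THEN conjunct1]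
      ex[THEN conjunct2, THEN conjunct2, THEN conjunct1]
      ex[THEN conjunct2, THEN conjunct2, THEN conjunct2, THEN spec, THEN spec, THEN mp, THEN mp, THEN mp]
    show "\<exists>A0. a0 \<in> A0 \<and> A0 \<subseteq> balls (M n) (s n) (mball_of (M n) y (s (Suc (Suc n)))) \<and>
        (finite A0 \<and> card A0 \<in> {\<beta> n, Suc (\<beta> n)}) \<and>
        (\<forall>(J :: 'c set set) j0. finite J \<and> card J \<in> {\<beta> (Suc n), Suc (\<beta> (Suc n))} \<longrightarrow> j0 \<in> J \<longrightarrow>
          (\<exists>h \<in> balls (M n) (s n) (mball_of (M n) y (s (Suc (Suc n)))) \<rightarrow> J.
             (\<forall>j\<in>J. finite {a \<in> balls (M n) (s n) (mball_of (M n) y (s (Suc (Suc n)))). h a = j} \<and>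
               card {a \<in> balls (M n) (s n) (mball_of (M n) y (s (Suc (Suc n)))). h a = j} \<in> {\<beta> n, Suc (\<beta> n)}) \<and>
             {a \<in> balls (M n) (s n) (mball_of (M n) y (s (Suc (Suc n)))). h a = j0} = A0))"
      unfolding A_def[symmetric]
    proof (intro exI[of _ A0] conjI allI impI)
      show "finite A0" using A0(2) A(1) by (rule finite_subset)
      fix J :: "'c set set" and j0
      assume J: "finite J \<and> card J \<in> {\<beta> (Suc n), Suc (\<beta> (Suc n))}" "j0 \<in> J"
      have "finite {a \<in> A n y. h a = j}" for h and j :: "'c set" using A(1) by simp
      then show "\<exists>h\<in>A n y \<rightarrow> J. (\<forall>j\<in>J. finite {a \<in> A n y. h a = j} \<and>
          card {a \<in> A n y. h a = j} \<in> {\<beta> n, Suc (\<beta> n)}) \<and> {a \<in> A n y. h a = j0} = A0"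
        using A0(4)[OF conjunct1[OF J(1)] conjunct2[OF J(1)] J(2)] by blast
    qed (use A0(1-3) in auto)
  qed
qed

lemma infinite_all:
  assumes inf: "\<And>s. \<epsilon>0 \<le> s \<Longrightarrow> \<exists>t. \<exists>x\<in>mspace (M 0). infinite (balls (M 0) s (mball_of (M 0) x t))"
    and "\<epsilon>0 \<le> s"
  shows "\<exists>t. \<forall>x\<in>mspace (M n). infinite (balls (M n) s (mball_of (M n) x t))"
  using assms(2)
proof (induction n arbitrary: s)
  case 0
  then obtain t x where x: "x \<in> mspace (M 0)" "infinite (balls (M 0) s (mball_of (M 0) x t))"
    using inf by blast
  have "infinite (balls (M 0) s (mball_of (M 0) y t))" if "y \<in> mspace (M 0)" for y
    using card_of_ordLeq_infinite[OF ordIso_imp_ordLeq[OF uniform[OF x(1) that]] x(2)] .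
  then show ?case by blast
next
  case (Suc n)
  obtain t where t: "\<And>x. x \<in> mspace (M n) \<Longrightarrow> infinite (balls (M n) \<epsilon>0 (mball_of (M n) x t))"
    using Suc.IH[OF order_refl] by blast
  obtain t' where t': "\<And>x y. x \<in> mspace (M n) \<Longrightarrow> y \<in> mspace (M (Suc n)) \<Longrightarrow>
      |balls (M n) \<epsilon>0 (mball_of (M n) x t)| \<le>o |balls (M (Suc n)) s (mball_of (M (Suc n)) y t')|"
    using dominated[OF order_refl Suc.prems, of n t] by blast
  obtain x where x: "x \<in> mspace (M n)" using M_nonempty[of n] by blast
  have "infinite (balls (M (Suc n)) s (mball_of (M (Suc n)) y t'))" if "y \<in> mspace (M (Suc n))" for y
    using card_of_ordLeq_infinite[OF t'[OF x that] t[OF x]] .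
  then show ?case by blast
qed

lemma finite_all:
  assumes fin: "\<And>t x. x \<in> mspace (M 0) \<Longrightarrow> finite (balls (M 0) s1 (mball_of (M 0) x t))"
    and s1: "\<epsilon>0 \<le> s1" and "s1 \<le> s" "x \<in> mspace (M n)"
  shows "finite (balls (M n) s (mball_of (M n) x t))"
  using assms(3,4)
proof (induction n arbitrary: s x t)
  case 0
  have "|balls (M 0) s (mball_of (M 0) x t)| \<le>o |balls (M 0) s1 (mball_of (M 0) x t)|"
    using \<epsilon>0_pos s1 0 by (intro balls_antimono ultra) auto
  then show ?case using fin[OF 0(2)] by (rule card_of_ordLeq_finite)
next
  case (Suc n)
  have "\<epsilon>0 \<le> s" using Suc.prems(1) s1 by simp
  then obtain t' where t': "\<And>y. y \<in> mspace (M n) \<Longrightarrow>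
      |balls (M (Suc n)) s (mball_of (M (Suc n)) x t)| \<le>o |balls (M n) s1 (mball_of (M n) y t')|"
    using dominated[of s s1 "Suc n" t] s1 Suc.prems(2) unfolding M_step by blast
  obtain y where y: "y \<in> mspace (M n)" using M_nonempty[of n] by blast
  show ?case using t'[OF y] Suc.IH[OF order_refl y] by (rule card_of_ordLeq_finite)
qed

text \<open>
  Either, at every scale, some ball contains infinitely many balls of that scale, or from some scale on
  every ball contains only finitely many. By domination both spaces fall into the same case.
\<close>

theorem spaces_linked: linked
proof (cases "\<forall>s\<ge>\<epsilon>0. \<exists>t. \<exists>x\<in>mspace (M 0). infinite (balls (M 0) s (mball_of (M 0) x t))")
  case True
  then show ?thesis by (intro linked_infinite infinite_all) auto
next
  case False
  then obtain s1 where s1: "\<epsilon>0 \<le> s1"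
    "\<And>t x. x \<in> mspace (M 0) \<Longrightarrow> finite (balls (M 0) s1 (mball_of (M 0) x t))" by blast
  interpret coarser: alternating M s1
  proof
    show "\<exists>t'. \<forall>x\<in>mspace (M n). \<forall>y\<in>mspace (M (Suc n)).
        |balls (M n) s (mball_of (M n) x t)| \<le>o |balls (M (Suc n)) s' (mball_of (M (Suc n)) y t')|"
      if "s1 \<le> s" "s1 \<le> s'" for s s' n t
      by (rule dominated) (use that s1(1) in linarith)+
  qed (use M_step M_disjoint M_nonempty ultra uniform unbounded s1(1) \<epsilon>0_pos in auto)
  show ?thesis
    by (rule coarser.linked_finite) (rule finite_all[OF s1(2,1)])
qed

end

section \<open>Placing two spaces on one type\<close>

definition metric_image :: "('a \<Rightarrow> 'c) \<Rightarrow> 'a metric \<Rightarrow> 'c metric" where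
  "metric_image f X = metric (f ` mspace X, \<lambda>u v. mdist X (inv f u) (inv f v))"

context
  fixes f :: "'a \<Rightarrow> 'c" and X :: "'a metric"
  assumes f: "inj f"
begin

lemma Metric_space_image: "Metric_space (f ` mspace X) (\<lambda>u v. mdist X (inv f u) (inv f v))"
  by unfold_locales (auto simp: f mdist_commute mdist_triangle)

lemma mspace_metric_image [simp]: "mspace (metric_image f X) = f ` mspace X"
  unfolding metric_image_def by (rule Metric_space.mspace_metric[OF Metric_space_image])

lemma mdist_metric_image [simp]: "mdist (metric_image f X) (f x) (f y) = mdist X x y"
  unfolding metric_image_def by (simp add: Metric_space.mdist_metric[OF Metric_space_image] f)

lemma ultrametric_metric_image: "ultrametric X \<Longrightarrow> ultrametric (metric_image f X)"
  by (simp add: ultrametric_def)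

lemma mball_of_metric_image: "mball_of (metric_image f X) (f x) t = f ` mball_of X x t"
proof (intro set_eqI iffI)
  fix v assume v: "v \<in> mball_of (metric_image f X) (f x) t"
  then obtain y where y: "y \<in> mspace X" "v = f y" by auto
  moreover have "x \<in> mspace X" using v f by (auto simp: inj_image_mem_iff)
  ultimately show "v \<in> f ` mball_of X x t" using v by auto
qed auto

lemma card_balls_metric_image:
  "|balls (metric_image f X) s (mball_of (metric_image f X) (f x) t)| =o |balls X s (mball_of X x t)|"
proof -
  have "balls (metric_image f X) s (mball_of (metric_image f X) (f x) t) = (`) f ` balls X s (mball_of X x t)"
    by (simp only: balls_def mball_of_metric_image image_image)
  moreover have "inj_on ((`) f) (balls X s (mball_of X x t))"
    using f by (auto simp: inj_on_def inj_image_eq_iff)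
  ultimately have "bij_betw ((`) f) (balls X s (mball_of X x t))
      (balls (metric_image f X) s (mball_of (metric_image f X) (f x) t))"
    by (simp only: bij_betw_def)
  then show ?thesis by (intro ordIso_symmetric[OF card_of_ordIsoI])
qed

end

section \<open>The coarse classification\<close>

text \<open>
  At a scale beyond its diameter a bounded space is a single ball. By domination every ball of \<open>Y\<close>
  then consists of a single ball of radius \<open>\<epsilon>0\<close>.
\<close>

lemma bounded_dominated:
  fixes X :: "'a metric" and Y :: "'b metric"
  assumes "ultrametric X" "x \<in> mspace X" "mspace X \<subseteq> mball_of X x t0"
    and e: "0 < \<epsilon>0"
    and dom: "\<And>s s' t. \<epsilon>0 \<le> s \<Longrightarrow> \<epsilon>0 \<le> s' \<Longrightarrow> \<exists>t'. \<forall>y\<in>mspace Y. \<forall>x\<in>mspace X.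
      |balls Y s (mball_of Y y t)| \<le>o |balls X s' (mball_of X x t')|"
    and y: "y \<in> mspace Y"
  shows "mspace Y \<subseteq> mball_of Y y \<epsilon>0"
proof
  fix z assume z: "z \<in> mspace Y"
  define s where "s = max \<epsilon>0 t0"
  have "balls X s (mball_of X x t') \<subseteq> {mball_of X x s}" for t'
  proof
    fix b assume "b \<in> balls X s (mball_of X x t')"
    then obtain v where v: "v \<in> mspace X" "b = mball_of X v s" by (auto simp: balls_def)
    then have "mdist X x v < s" using subsetD[OF assms(3) v(1)] by (simp add: s_def less_max_iff_disj)
    then show "b \<in> {mball_of X x s}" using mball_eq[OF assms(1,2) v(1)] v(2) by simp
  qed
  then have single: "|balls X s (mball_of X x t')| \<le>o |{mball_of X x s}|" for t'
    by (rule card_of_mono1)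
  define t where "t = mdist Y y z + 1"
  obtain t' where "|balls Y \<epsilon>0 (mball_of Y y t)| \<le>o |balls X s (mball_of X x t')|"
    using dom[of \<epsilon>0 s t] y assms(2) by (auto simp: s_def)
  then have "|balls Y \<epsilon>0 (mball_of Y y t)| \<le>o |{mball_of X x s}|"
    using single by (rule ordLeq_transitive)
  then obtain g where g: "inj_on g (balls Y \<epsilon>0 (mball_of Y y t))"
      "g ` balls Y \<epsilon>0 (mball_of Y y t) \<subseteq> {mball_of X x s}"
    unfolding card_of_ordLeq[symmetric] by blast
  have yz: "y \<in> mball_of Y y t" "z \<in> mball_of Y y t" using y z by (simp_all add: t_def add_nonneg_pos)
  have in_balls: "mball_of Y v \<epsilon>0 \<in> balls Y \<epsilon>0 (mball_of Y y t)" if "v \<in> mball_of Y y t" for v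
    unfolding balls_def using that by (rule imageI)
  have "g (mball_of Y v \<epsilon>0) = mball_of X x s" if "v \<in> mball_of Y y t" for v
    using g(2) in_balls[OF that] by blast
  then have "g (mball_of Y y \<epsilon>0) = g (mball_of Y z \<epsilon>0)" using yz by simp
  then have "mball_of Y y \<epsilon>0 = mball_of Y z \<epsilon>0"
    using inj_onD[OF g(1)] in_balls yz by blast
  moreover have "z \<in> mball_of Y z \<epsilon>0" using z e by simp
  ultimately show "z \<in> mball_of Y y \<epsilon>0" by blast
qed

lemma coarsely_equivalent_bounded:
  assumes X: "x \<in> mspace X" "mspace X \<subseteq> mball_of X x s"
    and Y: "y \<in> mspace Y" "mspace Y \<subseteq> mball_of Y y t"
  shows "coarsely_equivalent X Y"
proof -
  have X': "mdist X x u \<le> s" if "u \<in> mspace X" for u using subsetD[OF X(2) that] by simp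
  have Y': "mdist Y y v \<le> t" if "v \<in> mspace Y" for v using subsetD[OF Y(2) that] by simp
  show ?thesis
    unfolding coarsely_equivalent_def
  proof (intro exI conjI)
    show "bornologous_map X Y (\<lambda>_. y)" "bornologous_map Y X (\<lambda>_. x)"
      unfolding bornologous_map_def using X(1) Y(1) by auto
    show "bdd_above ((\<lambda>u. mdist X x u) ` mspace X)" using X' by (intro bdd_aboveI2) auto
    show "bdd_above ((\<lambda>v. mdist Y y v) ` mspace Y)" using Y' by (intro bdd_aboveI2) auto
  qed
qed

text \<open>
  Copies of the two spaces in the sum type form an alternating sequence. The linking relation is total on
  both sides; \<open>f\<close> and \<open>g\<close> select related points. Both \<open>x\<close> and \<open>g (f x)\<close> are related to \<open>f x\<close>, and
  points with a common partner are uniformly close.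
\<close>

lemma unbounded_coarsely_equivalent:
  fixes X :: "'a metric" and Y :: "'b metric"
  assumes hX: "homogeneous_metric X" "ultrametric X" and hY: "homogeneous_metric Y" "ultrametric Y"
    and ne: "mspace X \<noteq> {}" "mspace Y \<noteq> {}"
    and unX: "\<And>x t. x \<in> mspace X \<Longrightarrow> \<not> mspace X \<subseteq> mball_of X x t"
    and unY: "\<And>y t. y \<in> mspace Y \<Longrightarrow> \<not> mspace Y \<subseteq> mball_of Y y t"
    and e: "0 < \<epsilon>0"
    and dXY: "\<And>s s' t. \<epsilon>0 \<le> s \<Longrightarrow> \<epsilon>0 \<le> s' \<Longrightarrow> \<exists>t'. \<forall>x\<in>mspace X. \<forall>y\<in>mspace Y.
      |balls X s (mball_of X x t)| \<le>o |balls Y s' (mball_of Y y t')|"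
    and dYX: "\<And>s s' t. \<epsilon>0 \<le> s \<Longrightarrow> \<epsilon>0 \<le> s' \<Longrightarrow> \<exists>t'. \<forall>y\<in>mspace Y. \<forall>x\<in>mspace X.
      |balls Y s (mball_of Y y t)| \<le>o |balls X s' (mball_of X x t')|"
  shows "coarsely_equivalent X Y"
proof -
  define X' where "X' = metric_image (Inl :: 'a \<Rightarrow> 'a + 'b) X"
  define Y' where "Y' = metric_image (Inr :: 'b \<Rightarrow> 'a + 'b) Y"
  have X'_simps: "mspace X' = Inl ` mspace X" "mdist X' (Inl x) (Inl x') = mdist X x x'" for x x'
    by (simp_all add: X'_def)
  have Y'_simps: "mspace Y' = Inr ` mspace Y" "mdist Y' (Inr y) (Inr y') = mdist Y y y'" for y y'
    by (simp_all add: Y'_def)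
  have ballX: "mball_of X' (Inl x) t = Inl ` mball_of X x t" for x t
    by (simp add: X'_def mball_of_metric_image)
  have ballY: "mball_of Y' (Inr y) t = Inr ` mball_of Y y t" for y t
    by (simp add: Y'_def mball_of_metric_image)
  have cX: "|balls X' s (mball_of X' (Inl x) t)| =o |balls X s (mball_of X x t)|" for s x t
    unfolding X'_def by (rule card_balls_metric_image) simp
  have cY: "|balls Y' s (mball_of Y' (Inr y) t)| =o |balls Y s (mball_of Y y t)|" for s y t
    unfolding Y'_def by (rule card_balls_metric_image) simp
  define M where "M n = (if even n then X' else Y')" for n :: nat
  interpret alternating M \<epsilon>0
  proof
    show "M (Suc (Suc n)) = M n" for n by (simp add: M_def)
    show "mspace (M 0) \<inter> mspace (M (Suc 0)) = {}" by (auto simp: M_def X'_simps Y'_simps)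
    show "mspace (M n) \<noteq> {}" for n using ne by (simp add: M_def X'_simps Y'_simps)
    show "ultrametric (M n)" for n
      using hX(2) hY(2) by (simp add: M_def X'_def Y'_def ultrametric_metric_image)
    show "|balls (M n) s (mball_of (M n) x t)| =o |balls (M n) s (mball_of (M n) y t)|"
      if xy: "x \<in> mspace (M n)" "y \<in> mspace (M n)" for x n y s t
    proof (cases "even n")
      case True
      then obtain a b where ab: "a \<in> mspace X" "b \<in> mspace X" "x = Inl a" "y = Inl b"
        using xy by (auto simp: M_def X'_simps)
      have "|balls X' s (mball_of X' x t)| =o |balls X' s (mball_of X' y t)|"
        unfolding ab(3,4)
        by (rule ordIso_transitive[OF ordIso_transitive[OF cX homogeneous_balls[OF hX(1) ab(1,2)]]
              ordIso_symmetric[OF cX]])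
      then show ?thesis using True by (simp add: M_def)
    next
      case False
      then obtain a b where ab: "a \<in> mspace Y" "b \<in> mspace Y" "x = Inr a" "y = Inr b"
        using xy by (auto simp: M_def Y'_simps)
      have "|balls Y' s (mball_of Y' x t)| =o |balls Y' s (mball_of Y' y t)|"
        unfolding ab(3,4)
        by (rule ordIso_transitive[OF ordIso_transitive[OF cY homogeneous_balls[OF hY(1) ab(1,2)]]
              ordIso_symmetric[OF cY]])
      then show ?thesis using False by (simp add: M_def)
    qed
    show "\<not> mspace (M n) \<subseteq> mball_of (M n) x t" for n x t
    proof
      assume sub: "mspace (M n) \<subseteq> mball_of (M n) x t"
      have x: "x \<in> mspace (M n)" using sub ne by (cases "even n") (auto simp: M_def X'_simps Y'_simps)
      show False
      proof (cases "even n")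
        case True
        then obtain a where a: "a \<in> mspace X" "x = Inl a" using x by (auto simp: M_def X'_simps)
        then have "Inl ` mspace X \<subseteq> (Inl ` mball_of X a t :: ('a + 'b) set)"
          using sub True by (simp only: M_def if_True X'_simps ballX)
        then have "mspace X \<subseteq> mball_of X a t" by (simp only: inj_image_subset_iff inj_Inl)
        then show False using unX a(1) by blast
      next
        case False
        then obtain a where a: "a \<in> mspace Y" "x = Inr a" using x by (auto simp: M_def Y'_simps)
        then have "Inr ` mspace Y \<subseteq> (Inr ` mball_of Y a t :: ('a + 'b) set)"
          using sub False by (simp only: M_def if_False Y'_simps ballY)
        then have "mspace Y \<subseteq> mball_of Y a t" by (simp only: inj_image_subset_iff inj_Inr)
        then show False using unY a(1) by blast
      qed
    qed
    show "0 < \<epsilon>0" by (rule e)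
    show "\<exists>t'. \<forall>x\<in>mspace (M n). \<forall>y\<in>mspace (M (Suc n)).
        |balls (M n) s (mball_of (M n) x t)| \<le>o |balls (M (Suc n)) s' (mball_of (M (Suc n)) y t')|"
      if s: "\<epsilon>0 \<le> s" "\<epsilon>0 \<le> s'" for s s' n t
    proof (cases "even n")
      case True
      obtain t' where t': "\<And>x y. x \<in> mspace X \<Longrightarrow> y \<in> mspace Y \<Longrightarrow>
          |balls X s (mball_of X x t)| \<le>o |balls Y s' (mball_of Y y t')|" using dXY[OF s] by meson
      have "|balls X' s (mball_of X' (Inl x) t)| \<le>o |balls Y' s' (mball_of Y' (Inr y) t')|"
        if "x \<in> mspace X" "y \<in> mspace Y" for x y
        by (rule ordLeq_ordIso_trans[OF ordIso_ordLeq_trans[OF cX t'[OF that]] ordIso_symmetric[OF cY]])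
      then show ?thesis using True by (intro exI[of _ t']) (auto simp: M_def X'_simps Y'_simps)
    next
      case False
      obtain t' where t': "\<And>x y. y \<in> mspace Y \<Longrightarrow> x \<in> mspace X \<Longrightarrow>
          |balls Y s (mball_of Y y t)| \<le>o |balls X s' (mball_of X x t')|" using dYX[OF s] by meson
      have "|balls Y' s (mball_of Y' (Inr y) t)| \<le>o |balls X' s' (mball_of X' (Inl x) t')|"
        if "y \<in> mspace Y" "x \<in> mspace X" for x y
        by (rule ordLeq_ordIso_trans[OF ordIso_ordLeq_trans[OF cY t'[OF that]] ordIso_symmetric[OF cX]])
      then show ?thesis using False by (intro exI[of _ t']) (auto simp: M_def X'_simps Y'_simps)
    qed
  qed
  obtain R where R: "sym R" "R \<subseteq> mspace X' \<times> mspace Y' \<union> mspace Y' \<times> mspace X'"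
      "Domain R = mspace X' \<union> mspace Y'"
    and ctrl: "\<And>n \<epsilon>. \<exists>\<delta>. \<forall>u v u' v'. (u, v) \<in> R \<longrightarrow> (u', v') \<in> R \<longrightarrow> u \<in> mspace (M n) \<longrightarrow> u' \<in> mspace (M n) \<longrightarrow>
       mdist (M n) u u' \<le> \<epsilon> \<longrightarrow> mdist (M (Suc n)) v v' \<le> \<delta>"
    using spaces_linked unfolding linked_def by (auto simp: M_def)
  have "\<exists>y. y \<in> mspace Y \<and> (Inl x, Inr y) \<in> R" if x: "x \<in> mspace X" for x
  proof -
    obtain v where "(Inl x, v) \<in> R" using x R(3) by (auto simp: X'_simps set_eq_iff Domain_iff)
    then show ?thesis using R(2) by (auto simp: X'_simps Y'_simps)
  qed
  then obtain f where f: "\<And>x. x \<in> mspace X \<Longrightarrow> f x \<in> mspace Y \<and> (Inl x, Inr (f x)) \<in> R" by metis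
  have "\<exists>x. x \<in> mspace X \<and> (Inr y, Inl x) \<in> R" if y: "y \<in> mspace Y" for y
  proof -
    obtain v where "(Inr y, v) \<in> R" using y R(3) by (auto simp: Y'_simps set_eq_iff Domain_iff)
    then show ?thesis using R(2) by (auto simp: X'_simps Y'_simps)
  qed
  then obtain g where g: "\<And>y. y \<in> mspace Y \<Longrightarrow> g y \<in> mspace X \<and> (Inr y, Inl (g y)) \<in> R" by metis
  have XY: "\<exists>\<delta>. \<forall>x y x' y'. (Inl x, Inr y) \<in> R \<longrightarrow> (Inl x', Inr y') \<in> R \<longrightarrow> x \<in> mspace X \<longrightarrow> x' \<in> mspace X \<longrightarrow>
      mdist X x x' \<le> \<epsilon> \<longrightarrow> mdist Y y y' \<le> \<delta>" for \<epsilon>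
  proof -
    obtain \<delta> where d: "\<forall>u v u' v'. (u, v) \<in> R \<longrightarrow> (u', v') \<in> R \<longrightarrow> u \<in> mspace (M 0) \<longrightarrow> u' \<in> mspace (M 0) \<longrightarrow>
       mdist (M 0) u u' \<le> \<epsilon> \<longrightarrow> mdist (M (Suc 0)) v v' \<le> \<delta>" using ctrl[of 0 \<epsilon>] ..
    show ?thesis
    proof (intro exI[of _ \<delta>] allI impI)
      fix x y x' y'
      assume "(Inl x, Inr y) \<in> R" "(Inl x', Inr y') \<in> R" "x \<in> mspace X" "x' \<in> mspace X" "mdist X x x' \<le> \<epsilon>"
      then show "mdist Y y y' \<le> \<delta>"
        using d[rule_format, of "Inl x" "Inr y" "Inl x'" "Inr y'"] by (simp add: M_def X'_simps Y'_simps)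
    qed
  qed
  have YX: "\<exists>\<delta>. \<forall>y x y' x'. (Inr y, Inl x) \<in> R \<longrightarrow> (Inr y', Inl x') \<in> R \<longrightarrow> y \<in> mspace Y \<longrightarrow> y' \<in> mspace Y \<longrightarrow>
      mdist Y y y' \<le> \<epsilon> \<longrightarrow> mdist X x x' \<le> \<delta>" for \<epsilon>
  proof -
    obtain \<delta> where d: "\<forall>u v u' v'. (u, v) \<in> R \<longrightarrow> (u', v') \<in> R \<longrightarrow> u \<in> mspace (M (Suc 0)) \<longrightarrow> u' \<in> mspace (M (Suc 0)) \<longrightarrow>
       mdist (M (Suc 0)) u u' \<le> \<epsilon> \<longrightarrow> mdist (M (Suc (Suc 0))) v v' \<le> \<delta>" using ctrl[of "Suc 0" \<epsilon>] ..
    show ?thesis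
    proof (intro exI[of _ \<delta>] allI impI)
      fix y x y' x'
      assume "(Inr y, Inl x) \<in> R" "(Inr y', Inl x') \<in> R" "y \<in> mspace Y" "y' \<in> mspace Y" "mdist Y y y' \<le> \<epsilon>"
      then show "mdist X x x' \<le> \<delta>"
        using d[rule_format, of "Inr y" "Inl x" "Inr y'" "Inl x'"] by (simp add: M_def X'_simps Y'_simps)
    qed
  qed
  show ?thesis
    unfolding coarsely_equivalent_def
  proof (intro exI conjI)
    show "bornologous_map X Y f" unfolding bornologous_map_def
    proof (intro conjI allI)
      fix \<epsilon> :: real
      obtain \<delta> where d: "\<forall>x y x' y'. (Inl x, Inr y) \<in> R \<longrightarrow> (Inl x', Inr y') \<in> R \<longrightarrow> x \<in> mspace X \<longrightarrow> x' \<in> mspace X \<longrightarrow>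
          mdist X x x' \<le> \<epsilon> \<longrightarrow> mdist Y y y' \<le> \<delta>" using XY ..
      show "\<exists>\<delta>. \<forall>x\<in>mspace X. \<forall>x'\<in>mspace X. mdist X x x' \<le> \<epsilon> \<longrightarrow> mdist Y (f x) (f x') \<le> \<delta>"
        by (intro exI[of _ \<delta>] ballI impI) (use d f in meson)
    qed (use f in blast)
    show "bornologous_map Y X g" unfolding bornologous_map_def
    proof (intro conjI allI)
      fix \<epsilon> :: real
      obtain \<delta> where d: "\<forall>y x y' x'. (Inr y, Inl x) \<in> R \<longrightarrow> (Inr y', Inl x') \<in> R \<longrightarrow> y \<in> mspace Y \<longrightarrow> y' \<in> mspace Y \<longrightarrow>
          mdist Y y y' \<le> \<epsilon> \<longrightarrow> mdist X x x' \<le> \<delta>" using YX ..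
      show "\<exists>\<delta>. \<forall>y\<in>mspace Y. \<forall>y'\<in>mspace Y. mdist Y y y' \<le> \<epsilon> \<longrightarrow> mdist X (g y) (g y') \<le> \<delta>"
        by (intro exI[of _ \<delta>] ballI impI) (use d g in meson)
    qed (use g in blast)
    obtain \<delta> where d: "\<forall>y x y' x'. (Inr y, Inl x) \<in> R \<longrightarrow> (Inr y', Inl x') \<in> R \<longrightarrow> y \<in> mspace Y \<longrightarrow> y' \<in> mspace Y \<longrightarrow>
        mdist Y y y' \<le> 0 \<longrightarrow> mdist X x x' \<le> \<delta>" using YX ..
    have "mdist X (g (f x)) x \<le> \<delta>" if x: "x \<in> mspace X" for x
    proof -
      have "(Inr (f x), Inl x) \<in> R" using f[OF x] R(1) by (auto dest: symD)
      moreover have "(Inr (f x), Inl (g (f x))) \<in> R" using f[OF x] g by blast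
      ultimately show ?thesis using d[rule_format, of "f x" "g (f x)" "f x" x] f[OF x] by simp
    qed
    then show "bdd_above ((\<lambda>x. mdist X (g (f x)) x) ` mspace X)" by (rule bdd_aboveI2)
    obtain \<delta>' where d': "\<forall>x y x' y'. (Inl x, Inr y) \<in> R \<longrightarrow> (Inl x', Inr y') \<in> R \<longrightarrow> x \<in> mspace X \<longrightarrow> x' \<in> mspace X \<longrightarrow>
        mdist X x x' \<le> 0 \<longrightarrow> mdist Y y y' \<le> \<delta>'" using XY ..
    have "mdist Y (f (g y)) y \<le> \<delta>'" if y: "y \<in> mspace Y" for y
    proof -
      have "(Inl (g y), Inr y) \<in> R" using g[OF y] R(1) by (auto dest: symD)
      moreover have "(Inl (g y), Inr (f (g y))) \<in> R" using g[OF y] f by blast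
      ultimately show ?thesis using d'[rule_format, of "g y" "f (g y)" "g y" y] g[OF y] by simp
    qed
    then show "bdd_above ((\<lambda>y. mdist Y (f (g y)) y) ` mspace Y)" by (rule bdd_aboveI2)
  qed
qed

theorem theorem3:
  fixes X :: "'a metric" and Y :: "'b metric"
  assumes "homogeneous_metric X" and "ultrametric X"
    and "homogeneous_metric Y" and "ultrametric Y"
  shows "coarsely_equivalent X Y \<longleftrightarrow> Ent_sharp X =o Ent_sharp Y"
proof
  assume "coarsely_equivalent X Y"
  then obtain f g where "bornologous_map X Y f" "bornologous_map Y X g"
     "bdd_above ((\<lambda>x. mdist X (g (f x)) x) ` mspace X)"
     "bdd_above ((\<lambda>y. mdist Y (f (g y)) y) ` mspace Y)"
    unfolding coarsely_equivalent_def by blast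
  then have "Ent_sharp X \<le>o Ent_sharp Y" "Ent_sharp Y \<le>o Ent_sharp X"
    using Ent_sharp_coarse_mono[of X Y f g] Ent_sharp_coarse_mono[of Y X g f] by simp_all
  then show "Ent_sharp X =o Ent_sharp Y" by (simp add: ordIso_iff_ordLeq)
next
  assume eq: "Ent_sharp X =o Ent_sharp Y"
  note eq' = ordIso_symmetric[OF eq]
  show "coarsely_equivalent X Y"
  proof (cases "mspace X = {} \<or> mspace Y = {}")
    case True
    then have "mspace X = {}" "mspace Y = {}"
      using Ent_sharp_eq_empty[OF eq] Ent_sharp_eq_empty[OF eq'] by blast+
    then show ?thesis by (simp add: coarsely_equivalent_def bornologous_map_def)
  next
    case False
    then obtain x0 y0 where x0: "x0 \<in> mspace X" and y0: "y0 \<in> mspace Y" by blast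
    obtain a where a: "a > 0" "\<forall>s\<ge>a. \<forall>s'\<ge>a. \<forall>t. \<exists>t'. \<forall>x\<in>mspace X. \<forall>y\<in>mspace Y.
        |balls X s (mball_of X x t)| \<le>o |balls Y s' (mball_of Y y t')|"
      using Ent_sharp_eq_balls_dominated[OF eq assms(2,4,3)] by (elim exE conjE)
    obtain b where b: "b > 0" "\<forall>s\<ge>b. \<forall>s'\<ge>b. \<forall>t. \<exists>t'. \<forall>y\<in>mspace Y. \<forall>x\<in>mspace X.
        |balls Y s (mball_of Y y t)| \<le>o |balls X s' (mball_of X x t')|"
      using Ent_sharp_eq_balls_dominated[OF eq' assms(4,2,1)] by (elim exE conjE)
    define \<epsilon>0 where "\<epsilon>0 = max a b"
    have e: "\<epsilon>0 > 0" using a(1) by (simp add: \<epsilon>0_def)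
    have dXY: "\<exists>t'. \<forall>x\<in>mspace X. \<forall>y\<in>mspace Y. |balls X s (mball_of X x t)| \<le>o |balls Y s' (mball_of Y y t')|"
      if "\<epsilon>0 \<le> s" "\<epsilon>0 \<le> s'" for s s' t
      using a(2)[rule_format, of s s' t] that by (simp add: \<epsilon>0_def)
    have dYX: "\<exists>t'. \<forall>y\<in>mspace Y. \<forall>x\<in>mspace X. |balls Y s (mball_of Y y t)| \<le>o |balls X s' (mball_of X x t')|"
      if "\<epsilon>0 \<le> s" "\<epsilon>0 \<le> s'" for s s' t
      using b(2)[rule_format, of s s' t] that by (simp add: \<epsilon>0_def)
    have bY: "mspace Y \<subseteq> mball_of Y y0 \<epsilon>0" if "x \<in> mspace X" "mspace X \<subseteq> mball_of X x t" for x t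
      using bounded_dominated[OF assms(2) that e dYX y0] .
    have bX: "mspace X \<subseteq> mball_of X x0 \<epsilon>0" if "y \<in> mspace Y" "mspace Y \<subseteq> mball_of Y y t" for y t
      using bounded_dominated[OF assms(4) that e dXY x0] .
    show ?thesis
    proof (cases "mspace X \<subseteq> mball_of X x0 \<epsilon>0")
      case True
      then show ?thesis using coarsely_equivalent_bounded[OF x0 True y0 bY[OF x0 True]] by blast
    next
      case False
      have unY: "\<not> mspace Y \<subseteq> mball_of Y y t" if "y \<in> mspace Y" for y t using bX[OF that] False by blast
      have unX: "\<not> mspace X \<subseteq> mball_of X x t" if "x \<in> mspace X" for x t
        using bY[OF that] unY[OF y0] by blast
      show ?thesis
        using unbounded_coarsely_equivalent[OF assms _ _ unX unY e dXY dYX] x0 y0 by blast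
    qed
  qed
qed

end
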